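(* Let $F$ be a finite field with $q$ elements and $G=\mathrm{GL}_4(F)$. Let $k\in\{1,3\}$ if $\operatorname{char}(F)\neq 2$ and $k=1$ if $\operatorname{char}(F)=2$. Let $X_k$ be the conjugacy class in $G$ of the involution $t=I(4,k)$. Then, for any such $k$, $\operatorname{Diam}\Gamma(G,X_k)=2$. Moreover, $$|\Delta_1(t)|=\begin{cases} q^4+2q^3-q^2-q-2 & \text{if } \operatorname{char}(F)=2,\\ q^4+q^3+q^2 & \text{if } \operatorname{char}(F)\neq 2,\end{cases}$$ $$|\Delta_2(t)|=\begin{cases} q^6+q^5-2q^3 & \text{if } \operatorname{char}(F)=2,\\ q^6+q^5-q^2-1 & \text{if } \operatorname{char}(F)\neq 2.\end{cases}$$
   Context: For a subset $X$ of a group $G$, the commuting graph $\Gamma(G,X)$ has vertex set $X$, and distinct $x,y\in X$ are joined by an edge iff $xy=yx$. The distance $d(x,y)$ is the number of edges in a shortest path from $x$ to $y$, and the diameter $\operatorname{Diam}\Gamma(G,X)$ of a connected graph is the maximum distance over all pairs of vertices. $\Delta_i(t)=\{x\in X_k\mid d(t,x)=i\}$, with $d$ the distance in $\Gamma(G,X_k)$. The involution $I(n,k)\in\mathrm{GL}_n(F)$ is defined as follows. If $\operatorname{char}(F)\neq 2$, $I(n,k)=\begin{pmatrix} I_{n-k} & 0\\ 0 & -I_k\end{pmatrix}$. If $\operatorname{char}(F)=2$, $I(n,k)=\begin{pmatrix} I_{n-k} & 0\\ (0\mid I_k) & I_k\end{pmatrix}$, where $(0\mid I_k)$ is the $k\times(n-k)$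 matrix whose last $k$ columns form $I_k$ and whose other columns are zero. *)

theory Defs
  imports
    "Jordan_Normal_Form.Matrix"
    "Graph_Theory.Pair_Digraph"
    "Graph_Theory.Shortest_Path"
    "HOL-Algebra.Group"
    "HOL-Library.Cardinality"
begin

definition GL :: "'a :: field itself \<Rightarrow> nat \<Rightarrow> 'a mat monoid" where
  "GL ty n = units_of (ring_mat ty n ())"

definition conjugacy_class :: "('g, 'm) monoid_scheme \<Rightarrow> 'g \<Rightarrow> 'g set" where
  "conjugacy_class G x = {g \<otimes>\<^bsub>G\<^esub> x \<otimes>\<^bsub>G\<^esub> inv\<^bsub>G\<^esub> g | g. g \<in> carrier G}"

text \<open>The graph theory library represents an undirected simple graph by a symmetric
  loop-free relation on its vertices.\<close>

definition commuting_graph :: "('g, 'm) monoid_scheme \<Rightarrow> 'g set \<Rightarrow> 'g pair_pre_digraph" where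
  "commuting_graph G X =
     \<lparr>pverts = X, parcs = {(x, y) \<in> X \<times> X. x \<noteq> y \<and> x \<otimes>\<^bsub>G\<^esub> y = y \<otimes>\<^bsub>G\<^esub> x}\<rparr>"

lemma pair_bidirected_digraph_commuting_graph:
  "pair_bidirected_digraph (commuting_graph G X)"
  by unfold_locales (auto simp: commuting_graph_def symmetric_def sym_def)

text \<open>Every edge has weight one, so \<open>graph_dist\<close> counts edges; it is infinite between
  different components. Hence a finite \<open>graph_diam\<close> entails that the graph is connected.\<close>

definition graph_dist :: "'v pair_pre_digraph \<Rightarrow> 'v \<Rightarrow> 'v \<Rightarrow> ereal" where
  "graph_dist \<Gamma> x y = wf_digraph.\<mu> (with_proj \<Gamma>) (\<lambda>_. 1) x y"

lemma graph_dist_commuting_graph: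
  fixes G (structure) and X
  defines "\<Gamma> \<equiv> commuting_graph G X"
  shows "graph_dist \<Gamma> x y =
    (INF p \<in> {p. pre_digraph.awalk (with_proj \<Gamma>) x p y}. ereal (real (length p)))"
proof -
  interpret pair_bidirected_digraph \<Gamma>
    unfolding \<Gamma>_def by (rule pair_bidirected_digraph_commuting_graph)
  have "awalk_cost (\<lambda>_. 1) p = real (length p)" for p
    by (induction p) simp_all
  then show ?thesis
    by (simp add: graph_dist_def \<mu>_def)
qed

definition graph_diam :: "'v pair_pre_digraph \<Rightarrow> ereal" where
  "graph_diam \<Gamma> = (SUP (x, y) \<in> pverts \<Gamma> \<times> pverts \<Gamma>. graph_dist \<Gamma> x y)"

definition sphere_at :: "'v pair_pre_digraph \<Rightarrow> nat \<Rightarrow> 'v \<Rightarrow> 'v set" where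
  "sphere_at \<Gamma> i t = {x \<in> pverts \<Gamma>. graph_dist \<Gamma> t x = ereal (real i)}"

text \<open>The block \<open>(0 | I\<^sub>k)\<close> of size \<open>k \<times> (n - k)\<close>: the zero-based entry \<open>(i, j)\<close> is one iff
  \<open>j = (n - 2 k) + i\<close>. In characteristic two the matrix is meaningful for \<open>2 k \<le> n\<close> only.\<close>

definition std_involution :: "nat \<Rightarrow> nat \<Rightarrow> 'a :: field mat" where
  "std_involution n k =
     (if CHAR('a) = 2
      then four_block_mat
             (1\<^sub>m (n - k)) (0\<^sub>m (n - k) k)
             (mat k (n - k) (\<lambda>(i, j). if j = (n - 2 * k) + i then 1 else 0)) (1\<^sub>m k)
      else four_block_mat
             (1\<^sub>m (n - k)) (0\<^sub>m (n - k) k)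
             (0\<^sub>m k (n - k)) (- 1\<^sub>m k))"

end

theory Submission
  imports Defs "HOL-Library.Product_Plus"
begin

text \<open>
  In every characteristic the elements of \<open>X\<close> are the matrices \<open>s (1 + v f\<^sup>T)\<close> with a fixed sign
  \<open>s\<close> and nonzero \<open>v\<close>, \<open>f\<close> such that \<open>f \<bullet> v = - 2\<close>: these are reflections up to sign if the
  characteristic is odd, and transvections if it is two. Two of them, given by \<open>(v, f)\<close> and
  \<open>(w, g)\<close>, commute iff they are equal or \<open>f \<bullet> w = 0 = g \<bullet> v\<close>. The spheres are
  therefore counted by pairs of vectors subject to linear conditions, each matrix arising from
  \<open>q - 1\<close> pairs. For two given matrices, a dimension count in \<open>F\<^sup>4\<close> yields a common neighbour,
  so the diameter is at most two.
\<close>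

section \<open>Distances in commuting graphs\<close>

text \<open>The value -2 comes from (1 + v f^T)^2 = 1 + (2 + f \<bullet> v) v f^T: it makes the
  square the identity. In characteristic two it reads f \<bullet> v = 0, so the split by
  characteristic becomes the split c = 0 against c \<noteq> 0 for the common value c = f \<bullet>
  v, which the lemmas mostly leave arbitrary. This is also why the two sets of formulas differ. For
  c = 0 a pair is orthogonal to itself, so t occurs among its own orthogonal partners; moreover w
  may be a multiple of v, and then the two linear conditions on g collapse into one. For c \<noteq>
  0 neither happens. The delicate point for common neighbours is c \<noteq> 0: a vector w is wanted
  in the common kernel of two forms but outside the span of two vectors, and in dimension four both
  spaces can have dimension two.\<close>

lemma pverts_commuting_graph: "pverts (commuting_graph G X) = X"
  by (simp add: commuting_graph_def)

lemma parcs_commuting_graph: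
  "parcs (commuting_graph G X) = {(x, y) \<in> X \<times> X. x \<noteq> y \<and> x \<otimes>\<^bsub>G\<^esub> y = y \<otimes>\<^bsub>G\<^esub> x}"
  by (simp add: commuting_graph_def)

lemma graph_dist_le_length:
  assumes "pre_digraph.awalk (with_proj (commuting_graph G X)) x p y"
  shows "graph_dist (commuting_graph G X) x y \<le> ereal (real (length p))"
  unfolding graph_dist_commuting_graph using assms by (intro INF_lower) auto

lemma graph_dist_ge:
  assumes "\<And>p. pre_digraph.awalk (with_proj (commuting_graph G X)) x p y \<Longrightarrow> m \<le> length p"
  shows "ereal (real m) \<le> graph_dist (commuting_graph G X) x y"
  unfolding graph_dist_commuting_graph using assms by (intro INF_greatest) auto

text \<open>Peeling off one arc leaves conditions of membership and commutation, so the short walks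
  that must be excluded in a lower bound are handled by cases on the arc list.\<close>

lemma commuting_graph_awalk_Cons:
  "pre_digraph.awalk (with_proj (commuting_graph G X)) x (e # p) y \<longleftrightarrow>
     fst e = x \<and> x \<in> X \<and> snd e \<in> X \<and> x \<noteq> snd e \<and> x \<otimes>\<^bsub>G\<^esub> snd e = snd e \<otimes>\<^bsub>G\<^esub> x \<and>
     pre_digraph.awalk (with_proj (commuting_graph G X)) (snd e) p y"
proof -
  interpret pair_bidirected_digraph "commuting_graph G X"
    by (rule pair_bidirected_digraph_commuting_graph)
  show ?thesis
    by (cases e) (auto simp: awalk_Cons_iff pverts_commuting_graph parcs_commuting_graph)
qed

lemma commuting_graph_awalk_Nil:
  "pre_digraph.awalk (with_proj (commuting_graph G X)) x [] y \<longleftrightarrow> x = y \<and> x \<in> X"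
proof -
  interpret pair_bidirected_digraph "commuting_graph G X"
    by (rule pair_bidirected_digraph_commuting_graph)
  show ?thesis
    by (auto simp: awalk_Nil_iff pverts_commuting_graph)
qed

lemmas commuting_graph_awalk = commuting_graph_awalk_Cons commuting_graph_awalk_Nil

lemma graph_dist_refl:
  assumes "x \<in> X"
  shows "graph_dist (commuting_graph G X) x x = 0"
proof (rule antisym)
  show "graph_dist (commuting_graph G X) x x \<le> 0"
    using graph_dist_le_length[of G X x "[]" x] assms
    by (simp add: commuting_graph_awalk zero_ereal_def)
  show "0 \<le> graph_dist (commuting_graph G X) x x"
    using graph_dist_ge[of G X x x 0] by (simp add: zero_ereal_def)
qed

lemma graph_dist_commute:
  assumes "x \<in> X" "y \<in> X" "x \<noteq> y" "x \<otimes>\<^bsub>G\<^esub> y = y \<otimes>\<^bsub>G\<^esub> x"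
  shows "graph_dist (commuting_graph G X) x y = 1"
proof (rule antisym)
  show "graph_dist (commuting_graph G X) x y \<le> 1"
    using graph_dist_le_length[of G X x "[(x, y)]" y] assms
    by (simp add: commuting_graph_awalk one_ereal_def)
  have "1 \<le> length p" if "pre_digraph.awalk (with_proj (commuting_graph G X)) x p y" for p
    using that assms by (cases p) (auto simp: commuting_graph_awalk)
  then show "1 \<le> graph_dist (commuting_graph G X) x y"
    using graph_dist_ge[of G X x y 1] by (simp add: one_ereal_def)
qed

lemma graph_dist_common_neighbour:
  assumes X: "x \<in> X" "y \<in> X" "z \<in> X" and nc: "x \<otimes>\<^bsub>G\<^esub> y \<noteq> y \<otimes>\<^bsub>G\<^esub> x"
    and z: "x \<otimes>\<^bsub>G\<^esub> z = z \<otimes>\<^bsub>G\<^esub> x" "z \<otimes>\<^bsub>G\<^esub> y = y \<otimes>\<^bsub>G\<^esub> z"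
  shows "graph_dist (commuting_graph G X) x y = 2"
proof (rule antisym)
  \<comment> \<open>\<open>z\<close> is not assumed distinct from the end points: if it were one of
    them, its commuting with the other would make \<open>x\<close> and \<open>y\<close>
    commute.\<close>
  have "x \<noteq> z" "z \<noteq> y"
    using nc z by auto
  then show "graph_dist (commuting_graph G X) x y \<le> 2"
    using graph_dist_le_length[of G X x "[(x, z), (z, y)]" y] X z
    by (simp add: commuting_graph_awalk)
  have "2 \<le> length p" if "pre_digraph.awalk (with_proj (commuting_graph G X)) x p y" for p
  proof (rule ccontr)
    assume "\<not> 2 \<le> length p"
    then consider "p = []" | e where "p = [e]"
      by (cases p; cases "tl p") auto
    then show False
      using that nc by cases (auto simp: commuting_graph_awalk)
  qed
  then show "2 \<le> graph_dist (commuting_graph G X) x y"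
    using graph_dist_ge[of G X x y 2] by simp
qed

text \<open>The hypothesis lets \<open>z\<close> coincide with \<open>x\<close> or \<open>y\<close>,
  so it can be verified without asking whether these commute. It leaves only the distances 0, 1 and
  2, and both spheres can be read off from the centraliser of \<open>t\<close> in \<open>X\<close>.
  A non-commuting pair makes the diameter reach 2.\<close>

lemma
  fixes G (structure)
  assumes common: "\<And>x y. x \<in> X \<Longrightarrow> y \<in> X \<Longrightarrow> \<exists>z\<in>X. x \<otimes> z = z \<otimes> x \<and> z \<otimes> y = y \<otimes> z"
  shows sphere_at_1_commuting_graph:
      "t \<in> X \<Longrightarrow> sphere_at (commuting_graph G X) 1 t = {x \<in> X. t \<otimes> x = x \<otimes> t} - {t}"
    and sphere_at_2_commuting_graph:
      "t \<in> X \<Longrightarrow> sphere_at (commuting_graph G X) 2 t = X - {x \<in> X. t \<otimes> x = x \<otimes> t}"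
    and graph_diam_commuting_graph:
      "\<exists>x\<in>X. \<exists>y\<in>X. x \<otimes> y \<noteq> y \<otimes> x \<Longrightarrow> graph_diam (commuting_graph G X) = 2"
proof -
  let ?d = "graph_dist (commuting_graph G X)"
  have dist: "?d x y = (if x = y then 0 else if x \<otimes> y = y \<otimes> x then 1 else 2)"
    if xy: "x \<in> X" "y \<in> X" for x y
  proof -
    obtain z where z: "z \<in> X" "x \<otimes> z = z \<otimes> x" "z \<otimes> y = y \<otimes> z"
      using common[OF xy] by blast
    show ?thesis
      using graph_dist_refl[OF xy(1), of G] graph_dist_commute[OF xy, of G]
        graph_dist_common_neighbour[OF xy z(1) _ z(2,3)] by auto
  qed
  show "sphere_at (commuting_graph G X) 1 t = {x \<in> X. t \<otimes> x = x \<otimes> t} - {t}" if "t \<in> X"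
    using that unfolding sphere_at_def pverts_commuting_graph
    by (auto simp: dist one_ereal_def zero_ereal_def numeral_eq_ereal split: if_splits)
  show "sphere_at (commuting_graph G X) 2 t = X - {x \<in> X. t \<otimes> x = x \<otimes> t}" if "t \<in> X"
    using that unfolding sphere_at_def pverts_commuting_graph
    by (auto simp: dist one_ereal_def zero_ereal_def numeral_eq_ereal split: if_splits)
  show "graph_diam (commuting_graph G X) = 2" if "\<exists>x\<in>X. \<exists>y\<in>X. x \<otimes> y \<noteq> y \<otimes> x"
  proof (rule antisym)
    show "graph_diam (commuting_graph G X) \<le> 2"
      unfolding graph_diam_def pverts_commuting_graph by (rule SUP_least) (auto simp: dist)
    from that obtain x y where xy: "x \<in> X" "y \<in> X" "x \<otimes> y \<noteq> y \<otimes> x"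
      by blast
    then have "2 = ?d x y"
      by (auto simp: dist)
    also have "\<dots> \<le> graph_diam (commuting_graph G X)"
      unfolding graph_diam_def pverts_commuting_graph by (rule SUP_upper2[of "(x, y)"]) (use xy in auto)
    finally show "2 \<le> graph_diam (commuting_graph G X)" .
  qed
qed

section \<open>Linear conditions on vectors over a finite field\<close>

lemma finite_carrier_vec [simp]: "finite (carrier_vec n :: 'a::finite vec set)"
  and card_carrier_vec: "card (carrier_vec n :: 'a::finite vec set) = CARD('a) ^ n"
proof -
  let ?L = "{xs :: 'a list. set xs \<subseteq> UNIV \<and> length xs = n}"
  have bij: "bij_betw list_of_vec (carrier_vec n :: 'a vec set) ?L"
  proof (rule bij_betw_byWitness[where f' = vec_of_list])
    show "\<forall>v\<in>carrier_vec n :: 'a vec set. vec_of_list (list_of_vec v) = v"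
      by (simp add: vec_list)
    show "\<forall>xs\<in>?L. list_of_vec (vec_of_list xs) = xs"
      by (simp add: list_vec)
    show "list_of_vec ` (carrier_vec n :: 'a vec set) \<subseteq> ?L"
      by (intro image_subsetI) simp
    show "vec_of_list ` ?L \<subseteq> carrier_vec n"
      by (intro image_subsetI carrier_vecI) simp
  qed
  show "finite (carrier_vec n :: 'a vec set)"
    unfolding bij_betw_finite[OF bij] by (rule finite_lists_length_eq[OF finite])
  show "card (carrier_vec n :: 'a vec set) = CARD('a) ^ n"
    unfolding bij_betw_same_card[OF bij] by (rule card_lists_length_eq[OF finite])
qed

text \<open>Translation by \<open>x0\<close> carries the kernel onto the fibre through
  \<open>x0\<close>. The target is any abelian group, so that tuples of scalar products are covered
  by componentwise addition.\<close>

lemma card_fibre_additive: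
  fixes \<phi> :: "'a::{field,finite} vec \<Rightarrow> 'b::ab_group_add"
  assumes add: "\<And>x y. x \<in> carrier_vec n \<Longrightarrow> y \<in> carrier_vec n \<Longrightarrow> \<phi> (x + y) = \<phi> x + \<phi> y"
    and x0: "x0 \<in> carrier_vec n"
  shows "card {x \<in> carrier_vec n. \<phi> x = \<phi> x0} = card {x \<in> carrier_vec n. \<phi> x = 0}"
proof -
  have minus: "\<phi> (x - x0) = \<phi> x - \<phi> x0" if "x \<in> carrier_vec n" for x
    using add[of "x - x0" x0] that x0 by (simp add: algebra_simps minus_add_uminus_vec)
  have cancel: "x - x0 + x0 = x" "x + x0 - x0 = x" if "x \<in> carrier_vec n" for x
    using that x0 by (auto intro!: eq_vecI)
  have "bij_betw (\<lambda>x. x + x0) {x \<in> carrier_vec n. \<phi> x = 0} {x \<in> carrier_vec n. \<phi> x = \<phi> x0}"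
    by (rule bij_betw_byWitness[where f' = "\<lambda>x. x - x0"])
       (use x0 in \<open>auto simp: add minus cancel\<close>)
  then show ?thesis
    by (rule bij_betw_same_card[symmetric])
qed

text \<open>Rank-nullity in counting form: all fibres over the image are as large as the kernel.
  Over a finite field this stands in for dimensions throughout.\<close>

lemma card_image_times_card_kernel:
  fixes \<phi> :: "'a::{field,finite} vec \<Rightarrow> 'b::ab_group_add"
  assumes add: "\<And>x y. x \<in> carrier_vec n \<Longrightarrow> y \<in> carrier_vec n \<Longrightarrow> \<phi> (x + y) = \<phi> x + \<phi> y"
  shows "CARD('a) ^ n = card (\<phi> ` carrier_vec n) * card {x \<in> carrier_vec n. \<phi> x = 0}"
proof -
  let ?V = "carrier_vec n :: 'a vec set"
  have "card ?V = (\<Sum>b\<in>\<phi> ` ?V. card {x \<in> ?V. \<phi> x = b})"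
    using sum.image_gen[of ?V "\<lambda>_. 1::nat" \<phi>] by simp
  also have "\<dots> = (\<Sum>b\<in>\<phi> ` ?V. card {x \<in> ?V. \<phi> x = 0})"
    by (rule sum.cong) (auto intro!: card_fibre_additive add)
  finally show ?thesis
    by (simp add: card_carrier_vec)
qed

lemma neq_vec_index:
  assumes "v \<in> carrier_vec n" "w \<in> carrier_vec n" "v \<noteq> w"
  shows "\<exists>i<n. v $ i \<noteq> w $ i"
proof (rule ccontr)
  assume "\<not> ?thesis"
  then have "v $ i = w $ i" if "i < n" for i
    using that by blast
  then have "v = w"
    using assms(1,2) by (intro eq_vecI) simp_all
  then show False
    using assms(3) by blast
qed

lemma nonzero_vec_index:
  assumes "v \<in> carrier_vec n" "v \<noteq> 0\<^sub>v n"
  obtains i where "i < n" "v $ i \<noteq> 0"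
proof -
  obtain i where "i < n" "v $ i \<noteq> 0\<^sub>v n $ i"
    using neq_vec_index[OF assms(1) zero_carrier_vec assms(2)] by blast
  then show thesis
    by (intro that[of i]) simp_all
qed

lemma exists_scalar_prod_nonzero:
  fixes v :: "'a::field vec"
  assumes "v \<in> carrier_vec n" "v \<noteq> 0\<^sub>v n"
  shows "\<exists>f\<in>carrier_vec n. f \<bullet> v \<noteq> 0"
proof -
  obtain i where i: "i < n" "v $ i \<noteq> 0"
    using assms by (rule nonzero_vec_index)
  then show ?thesis
    using assms by (intro bexI[of _ "unit_vec n i"]) auto
qed

text \<open>With \<open>a \<bullet> v \<noteq> 0\<close> and \<open>b \<bullet> w \<noteq> 0\<close>, one of \<open>a\<close>, \<open>b\<close>, \<open>a + b\<close> works.\<close>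

lemma exists_scalar_prod_nonzero2:
  fixes v w :: "'a::field vec"
  assumes v: "v \<in> carrier_vec n" "v \<noteq> 0\<^sub>v n" and w: "w \<in> carrier_vec n" "w \<noteq> 0\<^sub>v n"
  shows "\<exists>f\<in>carrier_vec n. f \<bullet> v \<noteq> 0 \<and> f \<bullet> w \<noteq> 0"
proof -
  obtain a where a: "a \<in> carrier_vec n" "a \<bullet> v \<noteq> 0"
    using exists_scalar_prod_nonzero[OF v] by blast
  obtain b where b: "b \<in> carrier_vec n" "b \<bullet> w \<noteq> 0"
    using exists_scalar_prod_nonzero[OF w] by blast
  consider "a \<bullet> w \<noteq> 0" | "b \<bullet> v \<noteq> 0" | "a \<bullet> w = 0" "b \<bullet> v = 0" by blast
  then show ?thesis
  proof cases
    case 3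
    then show ?thesis
      using a b v w by (intro bexI[of _ "a + b"]) (auto simp: add_scalar_prod_distrib[of _ n])
  qed (use a b in auto)
qed

text \<open>Vectors that are not proportional have a nonzero 2 x 2 minor \<open>D\<close>. The form
  sends u to the minor of \<open>v\<close> and u in the same two coordinates, divided by
  \<open>D\<close>; at \<open>v\<close> the two columns agree, so it vanishes there.\<close>

lemma exists_dual_vec:
  fixes v w :: "'a::field vec"
  assumes v: "v \<in> carrier_vec n" "v \<noteq> 0\<^sub>v n" and w: "w \<in> carrier_vec n"
    and indep: "\<And>\<mu>. w \<noteq> \<mu> \<cdot>\<^sub>v v"
  shows "\<exists>f\<in>carrier_vec n. f \<bullet> v = 0 \<and> f \<bullet> w = 1"
proof -
  obtain i where i: "i < n" "v $ i \<noteq> 0"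
    using v by (rule nonzero_vec_index)
  \<comment> \<open>If \<open>w\<close> were a multiple of \<open>v\<close>, coordinate
    \<open>i\<close> would force this scalar; a coordinate \<open>j\<close> where that multiple
    fails yields the minor.\<close>
  have "(w $ i / v $ i) \<cdot>\<^sub>v v \<in> carrier_vec n" "w \<noteq> (w $ i / v $ i) \<cdot>\<^sub>v v"
    using v indep by auto
  then obtain j where "j < n" "w $ j \<noteq> ((w $ i / v $ i) \<cdot>\<^sub>v v) $ j"
    using neq_vec_index[OF w] by blast
  then have j: "j < n" "w $ j \<noteq> (w $ i / v $ i) * v $ j"
    using v by auto
  define D where "D = v $ i * w $ j - v $ j * w $ i"
  have D: "D \<noteq> 0"
    using i j by (auto simp: D_def field_simps)
  let ?f = "(1 / D) \<cdot>\<^sub>v (v $ i \<cdot>\<^sub>v unit_vec n j + (- v $ j) \<cdot>\<^sub>v unit_vec n i)"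
  show ?thesis
  proof (intro bexI conjI)
    show "?f \<bullet> v = 0"
      using v i j by (simp add: add_scalar_prod_distrib[of _ n])
    show "?f \<bullet> w = 1"
      using w i j D by (simp add: add_scalar_prod_distrib[of _ n] D_def)
  qed auto
qed

text \<open>Using \<open>exists_dual_vec\<close> in both orders gives a dual pair for
  \<open>v\<close> and \<open>w\<close>; its linear combinations take all prescribed values.\<close>

lemma exists_scalar_prod_pair:
  fixes v w :: "'a::field vec"
  assumes v: "v \<in> carrier_vec n" "v \<noteq> 0\<^sub>v n" and w: "w \<in> carrier_vec n"
    and indep: "\<And>\<mu>. w \<noteq> \<mu> \<cdot>\<^sub>v v"
  shows "\<exists>f\<in>carrier_vec n. f \<bullet> v = a \<and> f \<bullet> w = b"
proof -
  have w0: "w \<noteq> 0\<^sub>v n"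
    using indep[of 0] v by auto
  have indep': "v \<noteq> \<mu> \<cdot>\<^sub>v w" for \<mu>
  proof
    assume *: "v = \<mu> \<cdot>\<^sub>v w"
    then have "\<mu> \<noteq> 0"
      using v w by auto
    then have "w = (1 / \<mu>) \<cdot>\<^sub>v v"
      using * by (simp add: smult_smult_assoc)
    then show False
      using indep by blast
  qed
  obtain f where f: "f \<in> carrier_vec n" "f \<bullet> v = 0" "f \<bullet> w = 1"
    using exists_dual_vec[OF v w indep] by blast
  obtain g where g: "g \<in> carrier_vec n" "g \<bullet> w = 0" "g \<bullet> v = 1"
    using exists_dual_vec[OF w w0 v(1) indep'] by blast
  show ?thesis
    using f g v w
    by (intro bexI[of _ "a \<cdot>\<^sub>v g + b \<cdot>\<^sub>v f"]) (auto simp: add_scalar_prod_distrib[of _ n])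
qed

text \<open>With a dual pair \<open>\<phi>\<close>, \<open>\<psi>\<close> for \<open>v\<close>,
  \<open>v'\<close>, the residue w - (\<phi> \<bullet> w) v - (\<psi> \<bullet> w) v' is nonzero by
  hypothesis. A coordinate of the residue, read as a form in w, kills \<open>v\<close> and
  \<open>v'\<close>; dividing it by its value \<open>D\<close> at the given \<open>w\<close>
  produces \<open>g\<close>. If \<open>v'\<close> is a multiple of \<open>v\<close>, zero included,
  it adds no condition.\<close>

lemma exists_separating_vec:
  fixes v v' w :: "'a::field vec"
  assumes v: "v \<in> carrier_vec n" "v \<noteq> 0\<^sub>v n" and v': "v' \<in> carrier_vec n" and w: "w \<in> carrier_vec n"
    and notin: "\<And>a b. w \<noteq> a \<cdot>\<^sub>v v + b \<cdot>\<^sub>v v'"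
  shows "\<exists>g\<in>carrier_vec n. g \<bullet> v = 0 \<and> g \<bullet> v' = 0 \<and> g \<bullet> w = 1"
proof (cases "\<exists>\<mu>. v' = \<mu> \<cdot>\<^sub>v v")
  case True
  then obtain \<mu> where \<mu>: "v' = \<mu> \<cdot>\<^sub>v v" by blast
  have "w \<noteq> a \<cdot>\<^sub>v v" for a
  proof -
    have "0 \<cdot>\<^sub>v v' = 0\<^sub>v n"
      using v' by auto
    then show ?thesis
      using notin[of a 0] v by simp
  qed
  then show ?thesis
    using exists_dual_vec[OF v w] v \<mu> by auto
next
  case False
  then have indep: "v' \<noteq> \<mu> \<cdot>\<^sub>v v" for \<mu> by blast
  obtain \<phi> where \<phi>: "\<phi> \<in> carrier_vec n" "\<phi> \<bullet> v = 1" "\<phi> \<bullet> v' = 0"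
    using exists_scalar_prod_pair[OF v v' indep] by blast
  obtain \<psi> where \<psi>: "\<psi> \<in> carrier_vec n" "\<psi> \<bullet> v = 0" "\<psi> \<bullet> v' = 1"
    using exists_scalar_prod_pair[OF v v' indep] by blast
  have "(\<phi> \<bullet> w) \<cdot>\<^sub>v v + (\<psi> \<bullet> w) \<cdot>\<^sub>v v' \<in> carrier_vec n"
    "w \<noteq> (\<phi> \<bullet> w) \<cdot>\<^sub>v v + (\<psi> \<bullet> w) \<cdot>\<^sub>v v'"
    using v v' notin by auto
  then obtain k where "k < n" "w $ k \<noteq> ((\<phi> \<bullet> w) \<cdot>\<^sub>v v + (\<psi> \<bullet> w) \<cdot>\<^sub>v v') $ k"
    using neq_vec_index[OF w] by blast
  then have k: "k < n" "w $ k \<noteq> (\<phi> \<bullet> w) * v $ k + (\<psi> \<bullet> w) * v' $ k"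
    using v v' by auto
  define D where "D = w $ k - (\<phi> \<bullet> w) * v $ k - (\<psi> \<bullet> w) * v' $ k"
  have D: "D \<noteq> 0"
    using k by (auto simp: D_def algebra_simps)
  define g where "g = (1 / D) \<cdot>\<^sub>v (unit_vec n k + ((- v $ k) \<cdot>\<^sub>v \<phi> + (- v' $ k) \<cdot>\<^sub>v \<psi>))"
  have g: "g \<in> carrier_vec n"
    using \<phi> \<psi> by (simp add: g_def)
  have "g \<bullet> u = (u $ k - (\<phi> \<bullet> u) * v $ k - (\<psi> \<bullet> u) * v' $ k) / D" if "u \<in> carrier_vec n" for u
    using that \<phi>(1) \<psi>(1) k(1) by (simp add: g_def add_scalar_prod_distrib[of _ n])
  then show ?thesis
    using g \<phi> \<psi> v v' w D by (intro bexI[of _ g]) (auto simp: D_def)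
qed

section \<open>Sizes of solution sets of linear equations\<close>

lemma card_scalar_prod_eq:
  fixes v :: "'a::{field,finite} vec"
  assumes v: "v \<in> carrier_vec (Suc m)" "v \<noteq> 0\<^sub>v (Suc m)"
  shows "card {f \<in> carrier_vec (Suc m). f \<bullet> v = a} = CARD('a) ^ m"
proof -
  let ?V = "carrier_vec (Suc m) :: 'a vec set"
  have add: "(x + y) \<bullet> v = x \<bullet> v + y \<bullet> v" if "x \<in> ?V" "y \<in> ?V" for x y
    using that v by (simp add: add_scalar_prod_distrib[of _ "Suc m"])
  have surj: "\<exists>f\<in>?V. f \<bullet> v = b" for b
  proof -
    obtain f where "f \<in> ?V" "f \<bullet> v \<noteq> 0"
      using exists_scalar_prod_nonzero[OF v] by blast
    then show ?thesis
      using v by (intro bexI[of _ "(b / (f \<bullet> v)) \<cdot>\<^sub>v f"]) auto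
  qed
  then have "(\<lambda>f. f \<bullet> v) ` ?V = UNIV"
    by (metis UNIV_eq_I imageI)
  then have "CARD('a) ^ m = card {f \<in> ?V. f \<bullet> v = 0}"
    using card_image_times_card_kernel[of "Suc m" "\<lambda>f. f \<bullet> v"] add by simp
  moreover obtain f0 where "f0 \<in> ?V" "f0 \<bullet> v = a"
    using surj by blast
  ultimately show ?thesis
    using card_fibre_additive[of "Suc m" "\<lambda>f. f \<bullet> v" f0] add by simp
qed

text \<open>Independence makes the pair of forms surjective onto F x F, so each of the q^2 fibres
  has q^m elements. The double successor keeps subtraction out of the exponent.\<close>

lemma card_scalar_prod_pair_eq:
  fixes v w :: "'a::{field,finite} vec"
  assumes v: "v \<in> carrier_vec (Suc (Suc m))" "v \<noteq> 0\<^sub>v (Suc (Suc m))"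
    and w: "w \<in> carrier_vec (Suc (Suc m))" and indep: "\<And>\<mu>. w \<noteq> \<mu> \<cdot>\<^sub>v v"
  shows "card {f \<in> carrier_vec (Suc (Suc m)). f \<bullet> v = a \<and> f \<bullet> w = b} = CARD('a) ^ m"
proof -
  let ?V = "carrier_vec (Suc (Suc m)) :: 'a vec set"
  let ?\<phi> = "\<lambda>f. (f \<bullet> v, f \<bullet> w)"
  have add: "?\<phi> (x + y) = ?\<phi> x + ?\<phi> y" if "x \<in> ?V" "y \<in> ?V" for x y
    using that v w by (simp add: add_scalar_prod_distrib[of _ "Suc (Suc m)"])
  have surj: "\<exists>f\<in>?V. f \<bullet> v = a \<and> f \<bullet> w = b" for a b
    using exists_scalar_prod_pair[OF v w indep] by blast
  have "p \<in> ?\<phi> ` ?V" for p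
    using surj[of "fst p" "snd p"] by force
  then have "?\<phi> ` ?V = UNIV"
    by blast
  then have "CARD('a) ^ m = card {f \<in> ?V. ?\<phi> f = 0}"
    using card_image_times_card_kernel[of "Suc (Suc m)" ?\<phi>] add by (simp add: card_prod)
  moreover obtain f0 where "f0 \<in> ?V" "f0 \<bullet> v = a" "f0 \<bullet> w = b"
    using surj by blast
  ultimately show ?thesis
    using card_fibre_additive[of "Suc (Suc m)" ?\<phi> f0] add by simp
qed

text \<open>The image may be smaller than F x F and the kernel accordingly larger. The bound serves
  the linear forms of two arbitrary class members, which may well be proportional.\<close>

lemma card_scalar_prod_pair_eq_0_ge:
  fixes v w :: "'a::{field,finite} vec"
  assumes "v \<in> carrier_vec (Suc (Suc m))" "w \<in> carrier_vec (Suc (Suc m))"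
  shows "CARD('a) ^ m \<le> card {f \<in> carrier_vec (Suc (Suc m)). f \<bullet> v = 0 \<and> f \<bullet> w = 0}"
proof -
  let ?V = "carrier_vec (Suc (Suc m)) :: 'a vec set"
  let ?\<phi> = "\<lambda>f. (f \<bullet> v, f \<bullet> w)"
  have add: "?\<phi> (x + y) = ?\<phi> x + ?\<phi> y" if "x \<in> ?V" "y \<in> ?V" for x y
    using that assms by (simp add: add_scalar_prod_distrib[of _ "Suc (Suc m)"])
  have "card (?\<phi> ` ?V) \<le> CARD('a) * CARD('a)"
    using card_mono[of "UNIV :: ('a \<times> 'a) set" "?\<phi> ` ?V"] by (simp add: card_prod)
  then have "card (?\<phi> ` ?V) * card {f \<in> ?V. ?\<phi> f = 0}
      \<le> (CARD('a) * CARD('a)) * card {f \<in> ?V. ?\<phi> f = 0}"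
    by (rule mult_le_mono1)
  moreover have "CARD('a) ^ Suc (Suc m) = card (?\<phi> ` ?V) * card {f \<in> ?V. ?\<phi> f = 0}"
    by (rule card_image_times_card_kernel) (rule add)
  ultimately have "(CARD('a) * CARD('a)) * CARD('a) ^ m
      \<le> (CARD('a) * CARD('a)) * card {f \<in> ?V. ?\<phi> f = 0}"
    by (simp add: mult.assoc)
  then show ?thesis
    by (simp add: zero_prod_def)
qed

text \<open>Pigeonhole: with a trivial kernel, the q^n vectors would inject into the q^3 triples of
  values.\<close>

lemma exists_nonzero_orthogonal3:
  fixes u v w :: "'a::{field,finite} vec"
  assumes "u \<in> carrier_vec n" "v \<in> carrier_vec n" "w \<in> carrier_vec n" "n > 3"
  shows "\<exists>g\<in>carrier_vec n. g \<noteq> 0\<^sub>v n \<and> g \<bullet> u = 0 \<and> g \<bullet> v = 0 \<and> g \<bullet> w = 0"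
proof (rule ccontr)
  assume none: "\<not> ?thesis"
  let ?V = "carrier_vec n :: 'a vec set"
  let ?\<phi> = "\<lambda>f. (f \<bullet> u, f \<bullet> v, f \<bullet> w)"
  have add: "?\<phi> (x + y) = ?\<phi> x + ?\<phi> y" if "x \<in> ?V" "y \<in> ?V" for x y
    using that assms by (simp add: add_scalar_prod_distrib[of _ n])
  have sub: "{f \<in> ?V. ?\<phi> f = 0} \<subseteq> {0\<^sub>v n}"
    using none by (auto simp: zero_prod_def)
  have "card {f \<in> ?V. ?\<phi> f = 0} \<le> 1"
    using card_mono[OF _ sub] by simp
  moreover have "card (?\<phi> ` ?V) \<le> CARD('a) ^ 3"
    using card_mono[of "UNIV :: ('a \<times> 'a \<times> 'a) set" "?\<phi> ` ?V"]
    by (simp add: card_prod power3_eq_cube mult.assoc)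
  ultimately have "card (?\<phi> ` ?V) * card {f \<in> ?V. ?\<phi> f = 0} \<le> CARD('a) ^ 3 * 1"
    by (intro mult_le_mono)
  moreover have "CARD('a) ^ n = card (?\<phi> ` ?V) * card {f \<in> ?V. ?\<phi> f = 0}"
    by (rule card_image_times_card_kernel) (rule add)
  ultimately have "CARD('a) ^ n \<le> CARD('a) ^ 3"
    by simp
  moreover have "CARD('a) ^ 3 < CARD('a) ^ n"
    using \<open>n > 3\<close> card_mono[of "UNIV :: 'a set" "{0, 1}"] by (intro power_strict_increasing) auto
  ultimately show False
    by simp
qed

section \<open>Scaled rank-one perturbations of the identity\<close>

lemma smult_vec_eq_0_iff:
  fixes v :: "'a::field vec"
  assumes "v \<in> carrier_vec n"
  shows "a \<cdot>\<^sub>v v = 0\<^sub>v n \<longleftrightarrow> a = 0 \<or> v = 0\<^sub>v n"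
proof (cases "v = 0\<^sub>v n")
  case False
  obtain i where i: "i < n" "v $ i \<noteq> 0"
    using assms False by (rule nonzero_vec_index)
  then have "a = 0" if "a \<cdot>\<^sub>v v = 0\<^sub>v n"
    using arg_cong[OF that, of "\<lambda>u. u $ i"] assms by auto
  then show ?thesis
    using False assms by auto
qed auto

section \<open>Algebra of the outer products v f^T\<close>

definition dyad :: "'a::semiring_0 vec \<Rightarrow> 'a vec \<Rightarrow> 'a mat" where
  "dyad v f = mat (dim_vec v) (dim_vec f) (\<lambda>(i, j). v $ i * f $ j)"

lemma dim_dyad [simp]: "dim_row (dyad v f) = dim_vec v" "dim_col (dyad v f) = dim_vec f"
  by (simp_all add: dyad_def)

lemma index_dyad [simp]: "i < dim_vec v \<Longrightarrow> j < dim_vec f \<Longrightarrow> dyad v f $$ (i, j) = v $ i * f $ j"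
  by (simp add: dyad_def)

lemma dyad_carrier [simp]:
  "v \<in> carrier_vec n \<Longrightarrow> f \<in> carrier_vec m \<Longrightarrow> dyad v f \<in> carrier_mat n m"
  by (intro carrier_matI) simp_all

lemma dyad_smult_left: "dyad (a \<cdot>\<^sub>v v) f = a \<cdot>\<^sub>m dyad v (f :: 'a::comm_ring_1 vec)"
  by (rule eq_matI) auto

lemma dyad_smult_right: "dyad v (a \<cdot>\<^sub>v f) = a \<cdot>\<^sub>m dyad v (f :: 'a::comm_ring_1 vec)"
  by (rule eq_matI) auto

lemma mult_dyad:
  assumes "A \<in> carrier_mat k n" "v \<in> carrier_vec n"
  shows "A * dyad v f = dyad (A *\<^sub>v v) (f :: 'a::comm_ring_1 vec)"
  using assms
  by (intro eq_matI) (auto simp: scalar_prod_def sum_distrib_right mult.assoc intro!: sum.cong)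

lemma dyad_mult:
  assumes "A \<in> carrier_mat n k" "f \<in> carrier_vec n"
  shows "dyad v f * A = dyad v (transpose_mat A *\<^sub>v (f :: 'a::comm_ring_1 vec))"
  using assms
  by (intro eq_matI) (auto simp: scalar_prod_def sum_distrib_left mult_ac intro!: sum.cong)

lemma dyad_mult_vec:
  assumes "f \<in> carrier_vec n" "w \<in> carrier_vec n"
  shows "dyad v f *\<^sub>v w = (f \<bullet> w) \<cdot>\<^sub>v (v :: 'a::comm_ring_1 vec)"
  using assms
  by (intro eq_vecI) (auto simp: scalar_prod_def sum_distrib_left mult_ac intro!: sum.cong)

lemma dyad_mult_dyad:
  assumes "v \<in> carrier_vec n" "f \<in> carrier_vec m" "w \<in> carrier_vec m"
  shows "dyad v f * dyad w g = (f \<bullet> w) \<cdot>\<^sub>m dyad v (g :: 'a::comm_ring_1 vec)"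
  using assms by (simp add: mult_dyad[of _ n m] dyad_mult_vec[of _ m] dyad_smult_left)

lemma dyad_eq_0_iff:
  fixes v f :: "'a::field vec"
  assumes "v \<in> carrier_vec n" "f \<in> carrier_vec m"
  shows "dyad v f = 0\<^sub>m n m \<longleftrightarrow> v = 0\<^sub>v n \<or> f = 0\<^sub>v m"
proof
  assume eq: "dyad v f = 0\<^sub>m n m"
  show "v = 0\<^sub>v n \<or> f = 0\<^sub>v m"
  proof (rule ccontr)
    assume "\<not> ?thesis"
    then have nz: "v \<noteq> 0\<^sub>v n" "f \<noteq> 0\<^sub>v m"
      by auto
    obtain i where "i < n" "v $ i \<noteq> 0"
      using assms(1) nz(1) by (rule nonzero_vec_index)
    moreover obtain j where "j < m" "f $ j \<noteq> 0"
      using assms(2) nz(2) by (rule nonzero_vec_index)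
    ultimately show False
      using arg_cong[OF eq, of "\<lambda>A. A $$ (i, j)"] assms by auto
  qed
qed (use assms in auto)

text \<open>A rank-one matrix determines its factors up to reciprocal scalars. At a nonzero entry
  (i, j) the scalar must be \<open>w $ i / v $ i\<close>; row i then yields \<open>g\<close> and
  column j yields \<open>w\<close>.\<close>

lemma dyad_eq_iff:
  fixes v w f g :: "'a::field vec"
  assumes v: "v \<in> carrier_vec n" "v \<noteq> 0\<^sub>v n" and f: "f \<in> carrier_vec m" "f \<noteq> 0\<^sub>v m"
    and w: "w \<in> carrier_vec n" and g: "g \<in> carrier_vec m"
  shows "dyad v f = dyad w g \<longleftrightarrow> (\<exists>\<mu>. \<mu> \<noteq> 0 \<and> w = \<mu> \<cdot>\<^sub>v v \<and> g = inverse \<mu> \<cdot>\<^sub>v f)"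
proof
  assume eq: "dyad v f = dyad w g"
  have eqij: "v $ i * f $ j = w $ i * g $ j" if "i < n" "j < m" for i j
    using arg_cong[OF eq, of "\<lambda>A. A $$ (i, j)"] that v f w g by auto
  obtain i where i: "i < n" "v $ i \<noteq> 0"
    using v by (rule nonzero_vec_index)
  obtain j where j: "j < m" "f $ j \<noteq> 0"
    using f by (rule nonzero_vec_index)
  have nz: "w $ i \<noteq> 0" "g $ j \<noteq> 0"
    using eqij[OF i(1) j(1)] i j by auto
  define \<mu> where "\<mu> = w $ i / v $ i"
  have \<mu>: "\<mu> \<noteq> 0"
    using nz i by (simp add: \<mu>_def)
  have g_eq: "g = inverse \<mu> \<cdot>\<^sub>v f"
    using f g i nz eqij[OF i(1)] by (intro eq_vecI) (auto simp: \<mu>_def field_simps)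
  have "w = \<mu> \<cdot>\<^sub>v v"
    using v w f j \<mu> eqij[OF _ j(1)] by (intro eq_vecI) (auto simp: g_eq field_simps)
  then show "\<exists>\<mu>. \<mu> \<noteq> 0 \<and> w = \<mu> \<cdot>\<^sub>v v \<and> g = inverse \<mu> \<cdot>\<^sub>v f"
    using \<mu> g_eq by blast
next
  assume "\<exists>\<mu>. \<mu> \<noteq> 0 \<and> w = \<mu> \<cdot>\<^sub>v v \<and> g = inverse \<mu> \<cdot>\<^sub>v f"
  then show "dyad v f = dyad w g"
    using v f by (auto simp: dyad_smult_left dyad_smult_right intro!: eq_matI)
qed

lemma smult_mat_mult_smult_mat:
  fixes A B :: "'a::comm_ring_1 mat"
  assumes "A \<in> carrier_mat k n" "B \<in> carrier_mat n m"
  shows "(s \<cdot>\<^sub>m A) * (r \<cdot>\<^sub>m B) = (s * r) \<cdot>\<^sub>m (A * B)"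
proof -
  have "(s \<cdot>\<^sub>m A) * (r \<cdot>\<^sub>m B) = s \<cdot>\<^sub>m (A * (r \<cdot>\<^sub>m B))"
    using assms by (intro mult_smult_assoc_mat smult_carrier_mat) auto
  also have "A * (r \<cdot>\<^sub>m B) = r \<cdot>\<^sub>m (A * B)"
    using assms by (intro mult_smult_distrib)
  finally show ?thesis
    by (auto simp: mult.assoc intro!: eq_matI)
qed

text \<open>The scalar stands outside because in odd characteristic diag(1, -1, -1, -1) differs from
  the identity by a matrix of rank three, but is -1 times a reflection. So \<open>s\<close> is 1 for
  \<open>k = 1\<close> and -1 for \<open>k = 3\<close>.\<close>

definition quasi_refl :: "'a::field \<Rightarrow> 'a vec \<Rightarrow> 'a vec \<Rightarrow> 'a mat" where
  "quasi_refl s v f = s \<cdot>\<^sub>m (1\<^sub>m (dim_vec v) + dyad v f)"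

lemma quasi_refl_carrier [simp]:
  "v \<in> carrier_vec n \<Longrightarrow> f \<in> carrier_vec n \<Longrightarrow> quasi_refl s v f \<in> carrier_mat n n"
  by (intro carrier_matI) (simp_all add: quasi_refl_def)

lemma quasi_refl_eq_iff:
  assumes "v \<in> carrier_vec n" "w \<in> carrier_vec n" "f \<in> carrier_vec n" "g \<in> carrier_vec n" "s \<noteq> 0"
  shows "quasi_refl s v f = quasi_refl s w g \<longleftrightarrow> dyad v f = dyad w g"
proof
  assume eq: "quasi_refl s v f = quasi_refl s w g"
  show "dyad v f = dyad w g"
  proof (rule eq_matI)
    fix i j assume "i < dim_row (dyad w g)" "j < dim_col (dyad w g)"
    then show "dyad v f $$ (i, j) = dyad w g $$ (i, j)"
      using arg_cong[OF eq, of "\<lambda>A. A $$ (i, j)"] assms by (auto simp: quasi_refl_def)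
  qed (use assms in auto)
qed (use assms in \<open>auto simp: quasi_refl_def\<close>)

lemma quasi_refl_mult:
  assumes "v \<in> carrier_vec n" "w \<in> carrier_vec n" "f \<in> carrier_vec n" "g \<in> carrier_vec n"
  shows "quasi_refl s v f * quasi_refl r w g =
    (s * r) \<cdot>\<^sub>m (1\<^sub>m n + dyad v f + dyad w g + (f \<bullet> w) \<cdot>\<^sub>m dyad v g)"
proof -
  have d: "dyad v f \<in> carrier_mat n n" "dyad w g \<in> carrier_mat n n" "dyad v g \<in> carrier_mat n n"
    using assms by auto
  have "(1\<^sub>m n + dyad v f) * (1\<^sub>m n + dyad w g)
      = (1\<^sub>m n + dyad w g) + (dyad v f + dyad v f * dyad w g)"
  proof -
    have "(1\<^sub>m n + dyad v f) * (1\<^sub>m n + dyad w g)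
        = 1\<^sub>m n * (1\<^sub>m n + dyad w g) + dyad v f * (1\<^sub>m n + dyad w g)"
      using d by (intro add_mult_distrib_mat[where nr = n and n = n and nc = n]) auto
    also have "dyad v f * (1\<^sub>m n + dyad w g) = dyad v f * 1\<^sub>m n + dyad v f * dyad w g"
      using d by (intro mult_add_distrib_mat[where nr = n and n = n and nc = n]) auto
    also have "dyad v f * 1\<^sub>m n = dyad v f"
      using d(1) by (rule right_mult_one_mat)
    also have "1\<^sub>m n * (1\<^sub>m n + dyad w g) = 1\<^sub>m n + dyad w g"
      using d(2) by (intro left_mult_one_mat add_carrier_mat)
    finally show ?thesis .
  qed
  also have "dyad v f * dyad w g = (f \<bullet> w) \<cdot>\<^sub>m dyad v g"
    using assms by (intro dyad_mult_dyad)
  also have "(1\<^sub>m n + dyad w g) + (dyad v f + (f \<bullet> w) \<cdot>\<^sub>m dyad v g)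
      = 1\<^sub>m n + dyad v f + dyad w g + (f \<bullet> w) \<cdot>\<^sub>m dyad v g"
    using assms by (intro eq_matI) auto
  finally have "(1\<^sub>m n + dyad v f) * (1\<^sub>m n + dyad w g)
      = 1\<^sub>m n + dyad v f + dyad w g + (f \<bullet> w) \<cdot>\<^sub>m dyad v g" .
  moreover have "quasi_refl s v f * quasi_refl r w g
      = (s * r) \<cdot>\<^sub>m ((1\<^sub>m n + dyad v f) * (1\<^sub>m n + dyad w g))"
    using d assms smult_mat_mult_smult_mat[of "1\<^sub>m n + dyad v f" n n "1\<^sub>m n + dyad w g" n s r]
    by (simp add: quasi_refl_def)
  ultimately show ?thesis
    by simp
qed

text \<open>In the product formula only the cross term, \<open>f \<bullet> w\<close> times v g^T, is
  not symmetric in the two factors; commuting therefore means equality of the two cross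
  terms.\<close>

lemma quasi_refl_commute_iff_dyad:
  assumes "v \<in> carrier_vec n" "w \<in> carrier_vec n" "f \<in> carrier_vec n" "g \<in> carrier_vec n" "s \<noteq> 0"
  shows "quasi_refl s v f * quasi_refl s w g = quasi_refl s w g * quasi_refl s v f \<longleftrightarrow>
    (f \<bullet> w) \<cdot>\<^sub>m dyad v g = (g \<bullet> v) \<cdot>\<^sub>m dyad w f"
    (is "?A = ?B \<longleftrightarrow> ?C = ?D")
proof
  assume eq: "?A = ?B"
  show "?C = ?D"
  proof (rule eq_matI)
    fix i j assume "i < dim_row ?D" "j < dim_col ?D"
    then show "?C $$ (i, j) = ?D $$ (i, j)"
      using arg_cong[OF eq, of "\<lambda>A. A $$ (i, j)"] assms by (auto simp: quasi_refl_mult[of _ n])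
  qed (use assms in auto)
next
  assume "?C = ?D"
  moreover have "1\<^sub>m n + dyad v f + dyad w g = 1\<^sub>m n + dyad w g + dyad v f"
    using assms by (intro eq_matI) auto
  ultimately show "?A = ?B"
    using assms by (simp add: quasi_refl_mult[of _ n])
qed

text \<open>If one of the scalars \<open>f \<bullet> w\<close>, \<open>g \<bullet> v\<close>
  vanishes, so does the other, since the dyads are nonzero. Otherwise equal cross terms make
  \<open>w\<close> a multiple of \<open>v\<close> and \<open>g\<close> a multiple of
  \<open>f\<close>, and the common value of \<open>f \<bullet> v\<close> and
  \<open>g \<bullet> w\<close> forces reciprocal multipliers, that is, equal matrices.\<close>

lemma quasi_refl_commute_iff:
  assumes v: "v \<in> carrier_vec n" "v \<noteq> 0\<^sub>v n" and f: "f \<in> carrier_vec n" "f \<noteq> 0\<^sub>v n"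
    and w: "w \<in> carrier_vec n" "w \<noteq> 0\<^sub>v n" and g: "g \<in> carrier_vec n" "g \<noteq> 0\<^sub>v n"
    and s: "s \<noteq> 0" and eq: "f \<bullet> v = g \<bullet> w"
  shows "quasi_refl s v f * quasi_refl s w g = quasi_refl s w g * quasi_refl s v f \<longleftrightarrow>
    f \<bullet> w = 0 \<and> g \<bullet> v = 0 \<or> quasi_refl s v f = quasi_refl s w g"
proof
  assume "quasi_refl s v f * quasi_refl s w g = quasi_refl s w g * quasi_refl s v f"
  then have comm: "(f \<bullet> w) \<cdot>\<^sub>m dyad v g = (g \<bullet> v) \<cdot>\<^sub>m dyad w f"
    using quasi_refl_commute_iff_dyad[OF v(1) w(1) f(1) g(1) s] by blast
  show "f \<bullet> w = 0 \<and> g \<bullet> v = 0 \<or> quasi_refl s v f = quasi_refl s w g"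
  proof (cases "f \<bullet> w = 0 \<or> g \<bullet> v = 0")
    case True
    have "f \<bullet> w = 0 \<longleftrightarrow> g \<bullet> v = 0"
    proof -
      have "(f \<bullet> w) \<cdot>\<^sub>v v = 0\<^sub>v n \<longleftrightarrow> (g \<bullet> v) \<cdot>\<^sub>v w = 0\<^sub>v n"
        using comm v f w g dyad_eq_0_iff[of "(f \<bullet> w) \<cdot>\<^sub>v v" n g n]
          dyad_eq_0_iff[of "(g \<bullet> v) \<cdot>\<^sub>v w" n f n]
        by (simp add: dyad_smult_left)
      then show ?thesis
        using v w by (simp add: smult_vec_eq_0_iff)
    qed
    then show ?thesis
      using True by blast
  next
    case False
    then have nz: "f \<bullet> w \<noteq> 0" "g \<bullet> v \<noteq> 0" by auto
    have "dyad ((f \<bullet> w) \<cdot>\<^sub>v v) g = dyad ((g \<bullet> v) \<cdot>\<^sub>v w) f"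
      using comm by (simp add: dyad_smult_left)
    moreover have "(f \<bullet> w) \<cdot>\<^sub>v v \<noteq> 0\<^sub>v n"
      using v nz by (simp add: smult_vec_eq_0_iff)
    ultimately obtain \<mu> where \<mu>: "\<mu> \<noteq> 0" "(g \<bullet> v) \<cdot>\<^sub>v w = \<mu> \<cdot>\<^sub>v ((f \<bullet> w) \<cdot>\<^sub>v v)"
        "f = inverse \<mu> \<cdot>\<^sub>v g"
      using dyad_eq_iff[of "(f \<bullet> w) \<cdot>\<^sub>v v" n g n "(g \<bullet> v) \<cdot>\<^sub>v w" f] v w f g by auto
    have g_eq: "g = \<mu> \<cdot>\<^sub>v f"
      using \<mu>(1) by (simp add: \<mu>(3) smult_smult_assoc)
    define \<nu> where "\<nu> = \<mu> * (f \<bullet> w) / (g \<bullet> v)"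
    have "w = inverse (g \<bullet> v) \<cdot>\<^sub>v ((g \<bullet> v) \<cdot>\<^sub>v w)"
      using nz by (simp add: smult_smult_assoc)
    then have w_eq: "w = \<nu> \<cdot>\<^sub>v v"
      by (simp add: \<mu>(2) smult_smult_assoc \<nu>_def field_simps)
    have \<nu>: "\<nu> \<noteq> 0"
      using nz \<mu> by (simp add: \<nu>_def)
    \<comment> \<open>Now \<open>f \<bullet> w\<close> is nonzero and equals \<open>\<nu>\<close>
      times \<open>f \<bullet> v\<close>, so the common value can be cancelled to give
      \<open>\<mu> * \<nu> = 1\<close>.\<close>
    have "f \<bullet> v \<noteq> 0"
      using nz(1) v f by (auto simp: w_eq)
    moreover have "f \<bullet> v = \<mu> * \<nu> * (f \<bullet> v)"
      using eq v f by (simp add: w_eq g_eq mult_ac)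
    ultimately have "\<mu> = inverse \<nu>"
      using \<nu> by (simp add: field_simps)
    then have "dyad v f = dyad w g"
      using dyad_eq_iff[OF v f w(1) g(1)] w_eq g_eq \<nu> by blast
    then show ?thesis
      using quasi_refl_eq_iff[OF v(1) w(1) f(1) g(1) s] by blast
  qed
next
  assume "f \<bullet> w = 0 \<and> g \<bullet> v = 0 \<or> quasi_refl s v f = quasi_refl s w g"
  then show "quasi_refl s v f * quasi_refl s w g = quasi_refl s w g * quasi_refl s v f"
  proof
    assume "f \<bullet> w = 0 \<and> g \<bullet> v = 0"
    moreover have "0 \<cdot>\<^sub>m dyad v g = 0 \<cdot>\<^sub>m dyad w f"
      by (rule eq_matI) (use v w f g in auto)
    ultimately show ?thesis
      using quasi_refl_commute_iff_dyad[OF v(1) w(1) f(1) g(1) s] by simp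
  qed simp
qed

text \<open>The fibres of the map are the orbits of the action \<open>(v, f) \<mapsto> (\<mu> v, \<mu>\<^sup>-\<^sup>1 f)\<close>.\<close>

lemma card_quasi_refl_image:
  fixes S :: "('a::{field,finite} vec \<times> 'a vec) set"
  assumes S: "S \<subseteq> (carrier_vec n - {0\<^sub>v n}) \<times> (carrier_vec n - {0\<^sub>v n})"
    and closed: "\<And>\<mu> v f. \<mu> \<noteq> 0 \<Longrightarrow> (v, f) \<in> S \<Longrightarrow> (\<mu> \<cdot>\<^sub>v v, inverse \<mu> \<cdot>\<^sub>v f) \<in> S"
    and s: "s \<noteq> 0"
  shows "card S = (CARD('a) - 1) * card ((\<lambda>(v, f). quasi_refl s v f) ` S)"
proof -
  let ?h = "\<lambda>(v, f). quasi_refl s v f"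
  have fin: "finite S"
    using S by (rule finite_subset) auto
  have fibre: "card {p \<in> S. ?h p = x} = CARD('a) - 1" if "x \<in> ?h ` S" for x
  proof -
    from that obtain v f where vf: "(v, f) \<in> S" "x = quasi_refl s v f"
      by auto
    then have v: "v \<in> carrier_vec n" "v \<noteq> 0\<^sub>v n" and f: "f \<in> carrier_vec n" "f \<noteq> 0\<^sub>v n"
      using S by auto
    have "{p \<in> S. ?h p = x} = (\<lambda>\<mu>. (\<mu> \<cdot>\<^sub>v v, inverse \<mu> \<cdot>\<^sub>v f)) ` (UNIV - {0})"
    proof (intro equalityI subsetI)
      fix p assume "p \<in> {p \<in> S. ?h p = x}"
      then obtain w g where wg: "p = (w, g)" "(w, g) \<in> S" "quasi_refl s v f = quasi_refl s w g"
        using vf by (cases p) auto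
      then have "w \<in> carrier_vec n" "g \<in> carrier_vec n"
        using S by auto
      then have "\<exists>\<mu>. \<mu> \<noteq> 0 \<and> w = \<mu> \<cdot>\<^sub>v v \<and> g = inverse \<mu> \<cdot>\<^sub>v f"
        using wg dyad_eq_iff[OF v f] quasi_refl_eq_iff[OF v(1) _ f(1) _ s] by blast
      then show "p \<in> (\<lambda>\<mu>. (\<mu> \<cdot>\<^sub>v v, inverse \<mu> \<cdot>\<^sub>v f)) ` (UNIV - {0})"
        using wg by auto
    next
      fix p assume "p \<in> (\<lambda>\<mu>. (\<mu> \<cdot>\<^sub>v v, inverse \<mu> \<cdot>\<^sub>v f)) ` (UNIV - {0})"
      then obtain \<mu> where \<mu>: "\<mu> \<noteq> 0" "p = (\<mu> \<cdot>\<^sub>v v, inverse \<mu> \<cdot>\<^sub>v f)"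
        by auto
      have "dyad v f = dyad (\<mu> \<cdot>\<^sub>v v) (inverse \<mu> \<cdot>\<^sub>v f)"
        using dyad_eq_iff[OF v f, of "\<mu> \<cdot>\<^sub>v v" "inverse \<mu> \<cdot>\<^sub>v f"] v f \<mu> by auto
      then have "quasi_refl s (\<mu> \<cdot>\<^sub>v v) (inverse \<mu> \<cdot>\<^sub>v f) = quasi_refl s v f"
        using quasi_refl_eq_iff[OF v(1) _ f(1) _ s, of "\<mu> \<cdot>\<^sub>v v" "inverse \<mu> \<cdot>\<^sub>v f"] v f by auto
      then show "p \<in> {p \<in> S. ?h p = x}"
        using \<mu> vf closed by auto
    qed
    moreover have "inj_on (\<lambda>\<mu>. (\<mu> \<cdot>\<^sub>v v, inverse \<mu> \<cdot>\<^sub>v f)) (UNIV - {0})"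
    proof (rule inj_onI)
      fix a b assume eq: "(a \<cdot>\<^sub>v v, inverse a \<cdot>\<^sub>v f) = (b \<cdot>\<^sub>v v, inverse b \<cdot>\<^sub>v f)"
      obtain g where g: "g \<in> carrier_vec n" "g \<bullet> v \<noteq> 0"
        using exists_scalar_prod_nonzero[OF v] by blast
      have "g \<bullet> (a \<cdot>\<^sub>v v) = g \<bullet> (b \<cdot>\<^sub>v v)"
        using eq by simp
      then show "a = b"
        using g v by simp
    qed
    ultimately show ?thesis
      by (simp add: card_image card_Diff_singleton)
  qed
  have "card S = (\<Sum>x\<in>?h ` S. card {p \<in> S. ?h p = x})"
    using sum.image_gen[OF fin, of "\<lambda>_. 1::nat" ?h] by simp
  then show ?thesis
    using fibre by simp
qed

section \<open>Conjugacy in the general linear group\<close>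

lemma mult_GL [simp]: "x \<otimes>\<^bsub>GL ty n\<^esub> y = x * y"
  by (simp add: GL_def units_of_def ring_mat_simps)

lemma carrier_GL:
  "carrier (GL TYPE('a::field) n) =
    {g \<in> carrier_mat n n. \<exists>h\<in>carrier_mat n n. h * g = 1\<^sub>m n \<and> g * h = 1\<^sub>m n}"
  by (simp add: GL_def units_of_def Units_def ring_mat_simps)

lemma inv_GL:
  fixes g :: "'a::field mat"
  assumes "g \<in> carrier_mat n n" "h \<in> carrier_mat n n" "h * g = 1\<^sub>m n" "g * h = 1\<^sub>m n"
  shows "inv\<^bsub>GL TYPE('a) n\<^esub> g = h"
proof -
  have "group (GL TYPE('a) n)"
    unfolding GL_def using ring.is_monoid[OF ring_mat] by (rule monoid.units_group)
  moreover have "\<one>\<^bsub>GL TYPE('a) n\<^esub> = 1\<^sub>m n"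
    by (simp add: GL_def units_of_def ring_mat_simps)
  ultimately show ?thesis
    using assms by (intro group.inv_equality) (auto simp: carrier_GL)
qed

text \<open>Names the inverse as a matrix \<open>h\<close> with both products equal to the identity.
  From here on conjugation is pure matrix algebra.\<close>

lemma conjugacy_class_GL:
  fixes x :: "'a::field mat"
  shows "conjugacy_class (GL TYPE('a) n) x =
    {g * x * h | g h. g \<in> carrier_mat n n \<and> h \<in> carrier_mat n n \<and> h * g = 1\<^sub>m n \<and> g * h = 1\<^sub>m n}"
    (is "?L = ?R")
proof (intro equalityI subsetI)
  fix y assume "y \<in> ?L"
  then obtain g where g: "g \<in> carrier (GL TYPE('a) n)"
      and y: "y = g * x * inv\<^bsub>GL TYPE('a) n\<^esub> g"
    by (auto simp: conjugacy_class_def)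
  then obtain h where h: "g \<in> carrier_mat n n" "h \<in> carrier_mat n n" "h * g = 1\<^sub>m n" "g * h = 1\<^sub>m n"
    by (auto simp: carrier_GL)
  then show "y \<in> ?R"
    using y inv_GL[OF h] by blast
next
  fix y assume "y \<in> ?R"
  then obtain g h where y: "y = g * x * h"
      and gh: "g \<in> carrier_mat n n" "h \<in> carrier_mat n n" "h * g = 1\<^sub>m n" "g * h = 1\<^sub>m n"
    by blast
  then have "g \<in> carrier (GL TYPE('a) n)"
    by (auto simp: carrier_GL)
  then show "y \<in> ?L"
    using y inv_GL[OF gh] by (auto simp: conjugacy_class_def)
qed

lemma conjugacy_class_GL_trans:
  fixes x :: "'a::field mat"
  assumes x: "x \<in> carrier_mat n n"
    and y: "y \<in> conjugacy_class (GL TYPE('a) n) x" and z: "z \<in> conjugacy_class (GL TYPE('a) n) y"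
  shows "z \<in> conjugacy_class (GL TYPE('a) n) x"
proof -
  obtain g h where g: "y = g * x * h" "g \<in> carrier_mat n n" "h \<in> carrier_mat n n"
      "h * g = 1\<^sub>m n" "g * h = 1\<^sub>m n"
    using y by (auto simp: conjugacy_class_GL)
  obtain g' h' where g': "z = g' * y * h'" "g' \<in> carrier_mat n n" "h' \<in> carrier_mat n n"
      "h' * g' = 1\<^sub>m n" "g' * h' = 1\<^sub>m n"
    using z by (auto simp: conjugacy_class_GL)
  have *: "(A * B) * (C * D) = 1\<^sub>m n"
    if "A \<in> carrier_mat n n" "B \<in> carrier_mat n n" "C \<in> carrier_mat n n" "D \<in> carrier_mat n n"
      "B * C = 1\<^sub>m n" "A * D = 1\<^sub>m n" for A B C D :: "'a mat"
  proof -
    have "(A * B) * (C * D) = A * ((B * C) * D)"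
      using that(1-4) by (simp add: assoc_mult_mat[of _ n n _ n _ n])
    then show ?thesis
      using that by simp
  qed
  have "z = (g' * g) * x * (h * h')"
    using g g' x by (simp add: assoc_mult_mat[of _ n n _ n _ n])
  moreover have "(h * h') * (g' * g) = 1\<^sub>m n" "(g' * g) * (h * h') = 1\<^sub>m n"
    using g g' by (auto intro!: *)
  ultimately show ?thesis
    unfolding conjugacy_class_GL using g g' by (blast intro: mult_carrier_mat)
qed

section \<open>Conjugating rank-one perturbations\<close>

lemma quasi_refl_mult_vec:
  assumes "v \<in> carrier_vec n" "f \<in> carrier_vec n" "u \<in> carrier_vec n"
  shows "quasi_refl 1 v f *\<^sub>v u = u + (f \<bullet> u) \<cdot>\<^sub>v v"
proof -
  have "1 \<cdot>\<^sub>m (1\<^sub>m n + dyad v f) = 1\<^sub>m n + dyad v f"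
    by (intro eq_matI) auto
  then have "quasi_refl 1 v f = 1\<^sub>m n + dyad v f"
    using assms by (simp add: quasi_refl_def)
  then show ?thesis
    using assms add_mult_distrib_mat_vec[of "1\<^sub>m n" n n "dyad v f" u]
    by (simp add: dyad_mult_vec[of _ n])
qed

lemma transpose_quasi_refl:
  assumes "v \<in> carrier_vec n" "f \<in> carrier_vec n"
  shows "transpose_mat (quasi_refl s v f) = quasi_refl s f v"
  using assms by (intro eq_matI) (auto simp: quasi_refl_def)

text \<open>By the Sherman-Morrison formula the inverse is again a rank-one perturbation, with
  \<open>v\<close> rescaled.\<close>

lemma quasi_refl_inverse:
  fixes v f :: "'a::field vec"
  assumes v: "v \<in> carrier_vec n" and f: "f \<in> carrier_vec n" and nz: "1 + f \<bullet> v \<noteq> 0"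
  shows "\<exists>h\<in>carrier_mat n n. h * quasi_refl 1 v f = 1\<^sub>m n \<and> quasi_refl 1 v f * h = 1\<^sub>m n"
proof -
  \<comment> \<open>The perturbations given by e v and v have the product 1 + (e + 1 + e (f
    \<bullet> v)) v f^T; this \<open>e\<close> makes the coefficient vanish.\<close>
  define e where "e = - 1 / (1 + f \<bullet> v)"
  have key: "e * (f \<bullet> v) = - 1 - e"
    using nz by (simp add: e_def field_simps)
  have "(f \<bullet> v) * (e * y) = - y - e * y" for y
  proof -
    have "(f \<bullet> v) * (e * y) = (e * (f \<bullet> v)) * y"
      by simp
    then show ?thesis
      by (simp only: key) (simp add: algebra_simps)
  qed
  then have "quasi_refl 1 (e \<cdot>\<^sub>v v) f * quasi_refl 1 v f = 1\<^sub>m n"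
    using v f by (auto intro!: eq_matI simp: quasi_refl_mult[of _ n] mult.assoc)
  moreover have "quasi_refl 1 v f * quasi_refl 1 (e \<cdot>\<^sub>v v) f = 1\<^sub>m n"
    using v f by (auto intro!: eq_matI simp: quasi_refl_mult[of _ n] key left_diff_distrib mult.assoc)
  ultimately show ?thesis
    using v f by (intro bexI[of _ "quasi_refl 1 (e \<cdot>\<^sub>v v) f"]) auto
qed

text \<open>Conjugation acts on the data of the matrix: on \<open>v\<close> by \<open>g\<close>, and
  on \<open>f\<close> by the transposed inverse.\<close>

lemma conjugate_quasi_refl:
  fixes v f :: "'a::field vec"
  assumes v: "v \<in> carrier_vec n" and f: "f \<in> carrier_vec n"
    and g: "g \<in> carrier_mat n n" and h: "h \<in> carrier_mat n n" and gh: "g * h = 1\<^sub>m n"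
  shows "g * quasi_refl s v f * h = quasi_refl s (g *\<^sub>v v) (transpose_mat h *\<^sub>v f)"
proof -
  have d: "dyad v f \<in> carrier_mat n n"
    using v f by simp
  have gv: "g *\<^sub>v v \<in> carrier_vec n"
    using g v by simp
  have "g * quasi_refl s v f = s \<cdot>\<^sub>m (g * (1\<^sub>m n + dyad v f))"
    using d g v by (simp add: quasi_refl_def mult_smult_distrib[of _ n n _ n])
  also have "g * (1\<^sub>m n + dyad v f) = g * 1\<^sub>m n + g * dyad v f"
    using d g by (intro mult_add_distrib_mat) auto
  also have "\<dots> = g + dyad (g *\<^sub>v v) f"
    using g v by (simp add: mult_dyad[of _ n n])
  finally have "g * quasi_refl s v f * h = s \<cdot>\<^sub>m ((g + dyad (g *\<^sub>v v) f) * h)"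
    using g h gv f by (simp add: mult_smult_assoc_mat[of _ n n _ n])
  also have "(g + dyad (g *\<^sub>v v) f) * h = g * h + dyad (g *\<^sub>v v) f * h"
    using g h gv f by (intro add_mult_distrib_mat) auto
  also have "dyad (g *\<^sub>v v) f * h = dyad (g *\<^sub>v v) (transpose_mat h *\<^sub>v f)"
    using h f by (intro dyad_mult)
  finally show ?thesis
    using g gh by (simp add: quasi_refl_def)
qed

text \<open>Nonzero vectors exclude the scalar matrix, and \<open>c\<close> is invariant under
  conjugation. It stays a parameter so that reflections (\<open>c\<close> nonzero) and transvections
  (\<open>c = 0\<close>) share one treatment.\<close>

definition quasi_refl_pairs :: "nat \<Rightarrow> 'a::field \<Rightarrow> ('a vec \<times> 'a vec) set" where
  "quasi_refl_pairs n c =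
    {(v, f). v \<in> carrier_vec n \<and> v \<noteq> 0\<^sub>v n \<and> f \<in> carrier_vec n \<and> f \<noteq> 0\<^sub>v n \<and> f \<bullet> v = c}"

lemma quasi_refl_pairs_transform:
  fixes v f :: "'a::field vec"
  assumes vf: "(v, f) \<in> quasi_refl_pairs n c"
    and g: "g \<in> carrier_mat n n" and h: "h \<in> carrier_mat n n" and hg: "h * g = 1\<^sub>m n"
  shows "(g *\<^sub>v v, transpose_mat h *\<^sub>v f) \<in> quasi_refl_pairs n c"
proof -
  have v: "v \<in> carrier_vec n" "v \<noteq> 0\<^sub>v n" and f: "f \<in> carrier_vec n" "f \<noteq> 0\<^sub>v n"
      and c: "f \<bullet> v = c"
    using vf by (auto simp: quasi_refl_pairs_def)
  have cancel: "h *\<^sub>v (g *\<^sub>v u) = u" if "u \<in> carrier_vec n" for u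
    using that g h hg assoc_mult_mat_vec[of h n n g n u] by simp
  have prod: "(transpose_mat h *\<^sub>v f) \<bullet> (g *\<^sub>v u) = f \<bullet> u" if "u \<in> carrier_vec n" for u
    using that g h f by (simp add: transpose_vec_mult_scalar[of h n n] cancel)
  have gv: "g *\<^sub>v v \<in> carrier_vec n" and hf: "transpose_mat h *\<^sub>v f \<in> carrier_vec n"
    using g h v f by auto
  \<comment> \<open>If the image were zero, every form \<open>u\<close> would vanish at
    \<open>v\<close>, because \<open>u \<bullet> v\<close> equals the product of the transformed
    form and the transformed vector.\<close>
  have "g *\<^sub>v v \<noteq> 0\<^sub>v n"
  proof
    assume 0: "g *\<^sub>v v = 0\<^sub>v n"
    obtain u where u: "u \<in> carrier_vec n" "u \<bullet> v \<noteq> 0"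
      using exists_scalar_prod_nonzero[OF v] by blast
    have "u \<bullet> v = (transpose_mat h *\<^sub>v u) \<bullet> (g *\<^sub>v v)"
      using u g h v gv by (simp only: transpose_vec_mult_scalar[OF h gv u(1)] cancel)
    also have "\<dots> = 0"
      using u h by (simp add: 0)
    finally show False
      using u by simp
  qed
  moreover have "transpose_mat h *\<^sub>v f \<noteq> 0\<^sub>v n"
  proof
    assume 0: "transpose_mat h *\<^sub>v f = 0\<^sub>v n"
    obtain u where u: "u \<in> carrier_vec n" "u \<bullet> f \<noteq> 0"
      using exists_scalar_prod_nonzero[OF f] by blast
    have "g *\<^sub>v u \<in> carrier_vec n"
      using g u by simp
    then have "f \<bullet> u = 0"
      using prod[OF u(1)] by (simp add: 0)
    then show False
      using u f comm_scalar_prod[of u n f] by simp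
  qed
  ultimately show ?thesis
    using gv hf prod[OF v(1)] c by (simp add: quasi_refl_pairs_def)
qed

lemma conjugacy_class_quasi_refl_subset:
  fixes v f :: "'a::field vec"
  assumes vf: "(v, f) \<in> quasi_refl_pairs n c"
  shows "conjugacy_class (GL TYPE('a) n) (quasi_refl s v f)
    \<subseteq> (\<lambda>(v, f). quasi_refl s v f) ` quasi_refl_pairs n c"
proof
  fix y assume "y \<in> conjugacy_class (GL TYPE('a) n) (quasi_refl s v f)"
  then obtain g h where y: "y = g * quasi_refl s v f * h" and g: "g \<in> carrier_mat n n"
      and h: "h \<in> carrier_mat n n" and hg: "h * g = 1\<^sub>m n" and gh: "g * h = 1\<^sub>m n"
    by (auto simp: conjugacy_class_GL)
  have v: "v \<in> carrier_vec n" and f: "f \<in> carrier_vec n"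
    using vf by (auto simp: quasi_refl_pairs_def)
  show "y \<in> (\<lambda>(v, f). quasi_refl s v f) ` quasi_refl_pairs n c"
    using quasi_refl_pairs_transform[OF vf g h hg] y conjugate_quasi_refl[OF v f g h gh] by force
qed

text \<open>A perturbation that moves \<open>v\<^sub>0\<close> to \<open>v\<close>, followed by the inverse of a perturbation that fixes \<open>v\<close>
  and corrects the linear form, shows that the group acts transitively on pairs.\<close>

lemma conjugacy_class_quasi_refl:
  fixes v\<^sub>0 f\<^sub>0 :: "'a::field vec"
  assumes vf0: "(v\<^sub>0, f\<^sub>0) \<in> quasi_refl_pairs n c"
  shows "conjugacy_class (GL TYPE('a) n) (quasi_refl s v\<^sub>0 f\<^sub>0) =
    (\<lambda>(v, f). quasi_refl s v f) ` quasi_refl_pairs n c"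
proof (rule antisym[OF conjugacy_class_quasi_refl_subset[OF vf0]])
  have v0: "v\<^sub>0 \<in> carrier_vec n" "v\<^sub>0 \<noteq> 0\<^sub>v n" and f0: "f\<^sub>0 \<in> carrier_vec n" "f\<^sub>0 \<noteq> 0\<^sub>v n"
      and c0: "f\<^sub>0 \<bullet> v\<^sub>0 = c"
    using vf0 by (auto simp: quasi_refl_pairs_def)
  \<comment> \<open>The two conditions have separate tasks. Value 1 at \<open>v\<^sub>0\<close>
    makes the perturbation by \<open>v - v\<^sub>0\<close> and \<open>b\<close> move
    \<open>v\<^sub>0\<close> exactly to \<open>v\<close>; a nonzero value at \<open>v\<close> makes
    it invertible, as \<open>1 + b \<bullet> (v - v\<^sub>0)\<close> equals
    \<open>b \<bullet> v\<close>. The forms are later treated in the same way.\<close>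
  have normalised: "\<exists>b\<in>carrier_vec n. b \<bullet> u = 1 \<and> b \<bullet> w \<noteq> 0"
    if u: "u \<in> carrier_vec n" "u \<noteq> 0\<^sub>v n" and w: "w \<in> carrier_vec n" "w \<noteq> 0\<^sub>v n" for u w :: "'a vec"
  proof -
    obtain a where "a \<in> carrier_vec n" "a \<bullet> u \<noteq> 0" "a \<bullet> w \<noteq> 0"
      using exists_scalar_prod_nonzero2[OF u w] by blast
    then show ?thesis
      using u w by (intro bexI[of _ "(1 / (a \<bullet> u)) \<cdot>\<^sub>v a"]) auto
  qed
  show "(\<lambda>(v, f). quasi_refl s v f) ` quasi_refl_pairs n c
    \<subseteq> conjugacy_class (GL TYPE('a) n) (quasi_refl s v\<^sub>0 f\<^sub>0)"
  proof clarify
    fix v f :: "'a vec" assume "(v, f) \<in> quasi_refl_pairs n c"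
    then have v: "v \<in> carrier_vec n" "v \<noteq> 0\<^sub>v n" and f: "f \<in> carrier_vec n" "f \<noteq> 0\<^sub>v n"
        and c: "f \<bullet> v = c"
      by (auto simp: quasi_refl_pairs_def)
    have "\<exists>f\<^sub>1. f\<^sub>1 \<in> carrier_vec n \<and> quasi_refl s v f\<^sub>1 \<in> conjugacy_class (GL TYPE('a) n) (quasi_refl s v\<^sub>0 f\<^sub>0)
        \<and> f\<^sub>1 \<noteq> 0\<^sub>v n \<and> f\<^sub>1 \<bullet> v = c"
    proof -
      obtain b where b: "b \<in> carrier_vec n" "b \<bullet> v\<^sub>0 = 1" "b \<bullet> v \<noteq> 0"
        using normalised[OF v0 v] by blast
      let ?g = "quasi_refl 1 (v - v\<^sub>0) b"
      have g: "?g \<in> carrier_mat n n"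
        using v v0 b by simp
      have "1 + b \<bullet> (v - v\<^sub>0) \<noteq> 0"
        using b v v0 by (simp add: scalar_prod_minus_distrib[of _ n])
      then obtain h where h: "h \<in> carrier_mat n n" "h * ?g = 1\<^sub>m n" "?g * h = 1\<^sub>m n"
        using quasi_refl_inverse[of "v - v\<^sub>0" n b] v v0 b by auto
      have gv: "?g *\<^sub>v v\<^sub>0 = v"
        using b v v0 by (auto simp: quasi_refl_mult_vec[of _ n] intro!: eq_vecI)
      have "?g * quasi_refl s v\<^sub>0 f\<^sub>0 * h = quasi_refl s v (transpose_mat h *\<^sub>v f\<^sub>0)"
        using conjugate_quasi_refl[OF v0(1) f0(1) g h(1,3)] gv by simp
      then have "quasi_refl s v (transpose_mat h *\<^sub>v f\<^sub>0)
          \<in> conjugacy_class (GL TYPE('a) n) (quasi_refl s v\<^sub>0 f\<^sub>0)"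
        unfolding conjugacy_class_GL using g h by (metis (mono_tags, lifting) mem_Collect_eq)
      moreover have "(v, transpose_mat h *\<^sub>v f\<^sub>0) \<in> quasi_refl_pairs n c"
        using quasi_refl_pairs_transform[OF vf0 g h(1,2)] by (simp add: gv)
      ultimately show ?thesis
        by (auto simp: quasi_refl_pairs_def)
    qed
    then obtain f\<^sub>1 where f1: "f\<^sub>1 \<in> carrier_vec n" "f\<^sub>1 \<noteq> 0\<^sub>v n" "f\<^sub>1 \<bullet> v = c"
        and mem: "quasi_refl s v f\<^sub>1 \<in> conjugacy_class (GL TYPE('a) n) (quasi_refl s v\<^sub>0 f\<^sub>0)"
      by blast
    obtain a where a: "a \<in> carrier_vec n" "a \<bullet> f\<^sub>1 = 1" "a \<bullet> f \<noteq> 0"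
      using normalised[OF f1(1,2) f] by blast
    let ?h = "quasi_refl 1 a (f - f\<^sub>1)"
    have h: "?h \<in> carrier_mat n n"
      using a f f1 by simp
    have "1 + (f - f\<^sub>1) \<bullet> a \<noteq> 0"
      using a f f1 comm_scalar_prod[of a n f] comm_scalar_prod[of a n f\<^sub>1]
      by (simp add: minus_scalar_prod_distrib[of _ n])
    then obtain g where g: "g \<in> carrier_mat n n" "g * ?h = 1\<^sub>m n" "?h * g = 1\<^sub>m n"
      using quasi_refl_inverse[of a n "f - f\<^sub>1"] a f f1 by auto
    \<comment> \<open>Both forms take the value \<open>c\<close> at \<open>v\<close>, so their
      difference kills \<open>v\<close>.\<close>
    have "?h *\<^sub>v v = v"
      using a f f1 v c by (auto simp: quasi_refl_mult_vec[of _ n] minus_scalar_prod_distrib[of _ n] intro!: eq_vecI)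
    then have gv: "g *\<^sub>v v = v"
      using g h v assoc_mult_mat_vec[of g n n ?h n v] by simp
    have hf: "transpose_mat ?h *\<^sub>v f\<^sub>1 = f"
      using a f f1 by (auto simp: transpose_quasi_refl[of _ n] quasi_refl_mult_vec[of _ n] intro!: eq_vecI)
    have "g * quasi_refl s v f\<^sub>1 * ?h = quasi_refl s v f"
      using conjugate_quasi_refl[OF v(1) f1(1) g(1) h g(2)] gv hf by simp
    then have "quasi_refl s v f \<in> conjugacy_class (GL TYPE('a) n) (quasi_refl s v f\<^sub>1)"
      unfolding conjugacy_class_GL using g h by (metis (mono_tags, lifting) mem_Collect_eq)
    then show "quasi_refl s v f \<in> conjugacy_class (GL TYPE('a) n) (quasi_refl s v\<^sub>0 f\<^sub>0)"
      using conjugacy_class_GL_trans[OF _ mem] v0 f0 by simp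
  qed
qed

section \<open>Counting\<close>

lemma two_eq_0_iff_CHAR: "(2 :: 'a::field) = 0 \<longleftrightarrow> CHAR('a) = 2"
proof
  assume "(2 :: 'a) = 0"
  then have "of_nat 2 = (0 :: 'a)"
    by simp
  then have "CHAR('a) dvd 2"
    by (simp only: of_nat_eq_0_iff_char_dvd)
  then have "CHAR('a) = 1 \<or> CHAR('a) = 2"
    using dvd_imp_le[of "CHAR('a)" 2] by (cases "CHAR('a)") (auto simp: le_Suc_eq numeral_2_eq_2)
  then show "CHAR('a) = 2"
    by simp
next
  assume "CHAR('a) = 2"
  then show "(2 :: 'a) = 0"
    using of_nat_CHAR[where 'a = 'a] by simp
qed

lemma std_involution_quasi_refl:
  assumes "k \<in> (if CHAR('a::field) = 2 then {1} else {1, 3})"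
  shows "\<exists>s v f. s \<noteq> 0 \<and> (v, f) \<in> quasi_refl_pairs 4 (- 2 :: 'a) \<and>
    std_involution 4 k = quasi_refl s v f"
proof -
  have less4: "i < 4 \<longleftrightarrow> i = 0 \<or> i = 1 \<or> i = 2 \<or> i = 3" for i :: nat
    by auto
  let ?e = "unit_vec 4 :: nat \<Rightarrow> 'a vec"
  consider "CHAR('a) = 2" "k = 1" | "CHAR('a) \<noteq> 2" "k = 1" | "CHAR('a) \<noteq> 2" "k = 3"
    using assms by (auto split: if_splits)
  then show ?thesis
  proof cases
    case 1
    then have two: "(2 :: 'a) = 0"
      by (simp add: two_eq_0_iff_CHAR)
    \<comment> \<open>The 1 x 3 block has its single one in column (4 - 2) + 0 = 2, so (3, 2) is the
      only nonzero entry off the diagonal.\<close>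
    have "std_involution 4 k = quasi_refl 1 (?e 3) (?e 2)"
      using 1 by (intro eq_matI)
        (auto simp: std_involution_def quasi_refl_def less4)
    moreover have "(?e 3, ?e 2) \<in> quasi_refl_pairs 4 (- 2)"
      by (simp add: quasi_refl_pairs_def two)
    ultimately show ?thesis
      by (metis zero_neq_one)
  next
    case 2
    then have two: "(2 :: 'a) \<noteq> 0"
      by (simp add: two_eq_0_iff_CHAR)
    have "std_involution 4 k = quasi_refl 1 (?e 3) ((- 2) \<cdot>\<^sub>v ?e 3)"
      using 2 by (intro eq_matI)
        (auto simp: std_involution_def quasi_refl_def less4)
    moreover have "(?e 3, (- 2) \<cdot>\<^sub>v ?e 3) \<in> quasi_refl_pairs 4 (- 2)"
      using two by (simp add: quasi_refl_pairs_def smult_vec_eq_0_iff)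
    ultimately show ?thesis
      by (metis zero_neq_one)
  next
    case 3
    then have two: "(2 :: 'a) \<noteq> 0"
      by (simp add: two_eq_0_iff_CHAR)
    \<comment> \<open>The reflection negates coordinate 0, and the sign moves the -1 to the other
      three.\<close>
    have "std_involution 4 k = quasi_refl (- 1) (?e 0) ((- 2) \<cdot>\<^sub>v ?e 0)"
      using 3 by (intro eq_matI)
        (auto simp: std_involution_def quasi_refl_def less4)
    moreover have "(?e 0, (- 2) \<cdot>\<^sub>v ?e 0) \<in> quasi_refl_pairs 4 (- 2)"
      using two by (simp add: quasi_refl_pairs_def smult_vec_eq_0_iff)
    moreover have "(- 1 :: 'a) \<noteq> 0"
      by simp
    ultimately show ?thesis
      by blast
  qed
qed

text \<open>The zero vector solves the equation only for \<open>c = 0\<close>, hence the correction.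
  Counts live in the integers so that differences are not truncated.\<close>

lemma card_nonzero_scalar_prod_eq:
  fixes v :: "'a::{field,finite} vec"
  assumes v: "v \<in> carrier_vec (Suc m)" "v \<noteq> 0\<^sub>v (Suc m)"
  shows "int (card ({f \<in> carrier_vec (Suc m). f \<bullet> v = c} - {0\<^sub>v (Suc m)})) =
    int CARD('a) ^ m - (if c = 0 then 1 else 0)"
proof (cases "c = 0")
  case True
  then have "0\<^sub>v (Suc m) \<in> {f \<in> carrier_vec (Suc m). f \<bullet> v = c}"
    using v by simp
  then show ?thesis
    using True card_scalar_prod_eq[OF v, of c] by (simp add: card_Diff_singleton of_nat_diff)
next
  case False
  then have "{f \<in> carrier_vec (Suc m). f \<bullet> v = c} - {0\<^sub>v (Suc m)} = {f \<in> carrier_vec (Suc m). f \<bullet> v = c}"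
    using v by auto
  then show ?thesis
    using False card_scalar_prod_eq[OF v, of c] by simp
qed

lemma finite_quasi_refl_pairs [simp]: "finite (quasi_refl_pairs n (c :: 'a::{field,finite}))"
  by (rule finite_subset[of _ "carrier_vec n \<times> carrier_vec n"]) (auto simp: quasi_refl_pairs_def)

lemma card_quasi_refl_pairs:
  fixes c :: "'a::{field,finite}"
  shows "int (card (quasi_refl_pairs (Suc m) c)) =
    (int CARD('a) ^ Suc m - 1) * (int CARD('a) ^ m - (if c = 0 then 1 else 0))"
proof -
  let ?V = "carrier_vec (Suc m) :: 'a vec set"
  let ?Z = "{0\<^sub>v (Suc m)} :: 'a vec set"
  have "quasi_refl_pairs (Suc m) c = (SIGMA v:?V - ?Z. {f \<in> ?V. f \<bullet> v = c} - ?Z)"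
    by (auto simp: quasi_refl_pairs_def)
  then have "int (card (quasi_refl_pairs (Suc m) c)) =
      (\<Sum>v\<in>?V - ?Z. int (card ({f \<in> ?V. f \<bullet> v = c} - ?Z)))"
    by simp
  also have "\<dots> = (\<Sum>v\<in>?V - ?Z. int CARD('a) ^ m - (if c = 0 then 1 else 0))"
    by (intro sum.cong refl card_nonzero_scalar_prod_eq) auto
  also have "int (card (?V - ?Z)) = int CARD('a) ^ Suc m - 1"
    by (simp add: card_Diff_singleton card_carrier_vec of_nat_diff)
  then have "(\<Sum>v\<in>?V - ?Z. int CARD('a) ^ m - (if c = 0 then 1 else 0)) =
      (int CARD('a) ^ Suc m - 1) * (int CARD('a) ^ m - (if c = 0 then 1 else 0))"
    by (simp only: sum_constant of_nat_id)
  finally show ?thesis .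
qed

text \<open>This is the orthogonality alternative of the commuting criterion. Equality is kept
  apart, because a pair \<open>(v, f)\<close> with value \<open>c\<close> belongs to its own set
  only for \<open>c = 0\<close>.\<close>

definition commuting_pairs :: "nat \<Rightarrow> 'a::field vec \<Rightarrow> 'a vec \<Rightarrow> 'a \<Rightarrow> ('a vec \<times> 'a vec) set" where
  "commuting_pairs n v f c = {(w, g) \<in> quasi_refl_pairs n c. f \<bullet> w = 0 \<and> g \<bullet> v = 0}"

lemma commuting_pairs_Sigma:
  fixes v f :: "'a::field vec"
  assumes "f \<in> carrier_vec n"
  shows "commuting_pairs n v f c =
    (SIGMA w:{w \<in> carrier_vec n. w \<bullet> f = 0} - {0\<^sub>v n}.
       {g \<in> carrier_vec n. g \<bullet> v = 0 \<and> g \<bullet> w = c} - {0\<^sub>v n})"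
  using assms comm_scalar_prod[of f n]
  by (auto simp: commuting_pairs_def quasi_refl_pairs_def)

text \<open>Since \<open>f \<bullet> v\<close> is nonzero, a nonzero \<open>w\<close> in the kernel
  of \<open>f\<close> is never a multiple of \<open>v\<close>. So the two conditions on
  \<open>g\<close> are independent for each of the q^(m+1) - 1 choices of \<open>w\<close>, and
  \<open>g \<bullet> w = c\<close> rules out the zero vector.\<close>

lemma card_commuting_pairs_nonzero:
  fixes v f :: "'a::{field,finite} vec"
  assumes vf: "(v, f) \<in> quasi_refl_pairs (Suc (Suc m)) c" and c: "c \<noteq> 0"
  shows "int (card (commuting_pairs (Suc (Suc m)) v f c)) =
    (int CARD('a) ^ Suc m - 1) * int CARD('a) ^ m"
proof -
  let ?n = "Suc (Suc m)"
  let ?W = "{w \<in> carrier_vec ?n. w \<bullet> f = 0} - {0\<^sub>v ?n}"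
  let ?G = "\<lambda>w. {g \<in> carrier_vec ?n. g \<bullet> v = 0 \<and> g \<bullet> w = c} - {0\<^sub>v ?n}"
  have v: "v \<in> carrier_vec ?n" "v \<noteq> 0\<^sub>v ?n" and f: "f \<in> carrier_vec ?n" "f \<noteq> 0\<^sub>v ?n"
      and fv: "f \<bullet> v = c"
    using vf by (auto simp: quasi_refl_pairs_def)
  have "card (?G w) = CARD('a) ^ m" if w: "w \<in> ?W" for w
  proof -
    have indep: "w \<noteq> \<mu> \<cdot>\<^sub>v v" for \<mu>
    proof
      assume *: "w = \<mu> \<cdot>\<^sub>v v"
      then have "\<mu> * c = 0"
        using w v f fv comm_scalar_prod[of f ?n v] by auto
      then show False
        using w v c * by auto
    qed
    have "?G w = {g \<in> carrier_vec ?n. g \<bullet> v = 0 \<and> g \<bullet> w = c}"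
      using w c by auto
    then show ?thesis
      using card_scalar_prod_pair_eq[OF v _ indep, of 0 c] w by simp
  qed
  then have "int (card (commuting_pairs ?n v f c)) = int (card ?W) * int CARD('a) ^ m"
    unfolding commuting_pairs_Sigma[OF f(1)] by (simp add: card_SigmaI)
  then show ?thesis
    using card_nonzero_scalar_prod_eq[OF f, of 0] by simp
qed

text \<open>Here \<open>v\<close> itself lies in the kernel of \<open>f\<close>. For the q - 1
  nonzero multiples \<open>w\<close> of \<open>v\<close> the conditions on \<open>g\<close>
  coincide, leaving q^(m+1) - 1 vectors; for the other q^(m+1) - q they are independent, leaving q^m
  - 1.\<close>

lemma card_commuting_pairs_zero:
  fixes v f :: "'a::{field,finite} vec"
  assumes vf: "(v, f) \<in> quasi_refl_pairs (Suc (Suc m)) 0"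
  shows "int (card (commuting_pairs (Suc (Suc m)) v f 0)) =
    (int CARD('a) - 1) * (int CARD('a) ^ Suc m - 1) +
    (int CARD('a) ^ Suc m - int CARD('a)) * (int CARD('a) ^ m - 1)"
proof -
  let ?n = "Suc (Suc m)"
  let ?q = "int CARD('a)"
  let ?W = "{w \<in> carrier_vec ?n. w \<bullet> f = 0} - {0\<^sub>v ?n}"
  let ?L = "(\<lambda>\<mu>. \<mu> \<cdot>\<^sub>v v) ` (UNIV - {0})"
  let ?G = "\<lambda>w. {g \<in> carrier_vec ?n. g \<bullet> v = 0 \<and> g \<bullet> w = 0} - {0\<^sub>v ?n}"
  have v: "v \<in> carrier_vec ?n" "v \<noteq> 0\<^sub>v ?n" and f: "f \<in> carrier_vec ?n" "f \<noteq> 0\<^sub>v ?n"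
      and fv: "f \<bullet> v = 0"
    using vf by (auto simp: quasi_refl_pairs_def)
  have LW: "?L \<subseteq> ?W"
    using v f fv comm_scalar_prod[of f ?n v] by (auto simp: smult_vec_eq_0_iff)
  have "inj_on (\<lambda>\<mu>. \<mu> \<cdot>\<^sub>v v) (UNIV - {0})"
  proof (rule inj_onI)
    fix a b assume eq: "a \<cdot>\<^sub>v v = b \<cdot>\<^sub>v v"
    obtain g where g: "g \<in> carrier_vec ?n" "g \<bullet> v \<noteq> 0"
      using exists_scalar_prod_nonzero[OF v] by blast
    have "g \<bullet> (a \<cdot>\<^sub>v v) = g \<bullet> (b \<cdot>\<^sub>v v)"
      using eq by simp
    then show "a = b"
      using g v by simp
  qed
  then have cardL: "int (card ?L) = ?q - 1"
    by (simp add: card_image card_Diff_singleton of_nat_diff)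
  have GL: "int (card (?G w)) = ?q ^ Suc m - 1" if w: "w \<in> ?L" for w
  proof -
    have "?G w = {g \<in> carrier_vec ?n. g \<bullet> v = 0} - {0\<^sub>v ?n}"
      using w v by auto
    then show ?thesis
      using card_nonzero_scalar_prod_eq[OF v, of 0] by simp
  qed
  have GW: "int (card (?G w)) = ?q ^ m - 1" if w: "w \<in> ?W - ?L" for w
  proof -
    have indep: "w \<noteq> \<mu> \<cdot>\<^sub>v v" for \<mu>
      using w v by (cases "\<mu> = 0") auto
    have "0\<^sub>v ?n \<in> {g \<in> carrier_vec ?n. g \<bullet> v = 0 \<and> g \<bullet> w = 0}"
      using w v by simp
    then show ?thesis
      using card_scalar_prod_pair_eq[OF v _ indep, of 0 0] w
      by (simp add: card_Diff_singleton of_nat_diff)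
  qed
  have cardW: "int (card ?W) = ?q ^ Suc m - 1"
    using card_nonzero_scalar_prod_eq[OF f, of 0] by simp
  have "int (card (?W - ?L)) = int (card ?W) - int (card ?L)"
    using LW card_mono[OF _ LW] by (subst card_Diff_subset) (auto simp: of_nat_diff)
  then have cardWL: "int (card (?W - ?L)) = ?q ^ Suc m - ?q"
    using cardW cardL by simp
  have "int (card (commuting_pairs ?n v f 0)) = (\<Sum>w\<in>?W. int (card (?G w)))"
    unfolding commuting_pairs_Sigma[OF f(1)] by (simp add: card_SigmaI)
  also have "\<dots> = (\<Sum>w\<in>?W - ?L. int (card (?G w))) + (\<Sum>w\<in>?L. int (card (?G w)))"
    using LW by (intro sum.subset_diff) auto
  also have "(\<Sum>w\<in>?L. int (card (?G w))) = (\<Sum>w\<in>?L. ?q ^ Suc m - 1)"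
    by (intro sum.cong refl GL)
  also have "(\<Sum>w\<in>?W - ?L. int (card (?G w))) = (\<Sum>w\<in>?W - ?L. ?q ^ m - 1)"
    by (intro sum.cong refl GW)
  finally show ?thesis
    by (simp only: sum_constant cardWL cardL of_nat_id add.commute)
qed

text \<open>For \<open>c = 0\<close> any nonzero \<open>w\<close> killed by both forms serves:
  \<open>g\<close> only has to be orthogonal to three vectors in dimension four. For nonzero
  \<open>c\<close>, \<open>g \<bullet> w = c\<close> forces \<open>w\<close> out of the span of
  \<open>v\<close> and \<open>v'\<close>; a separating form is then scaled by
  \<open>c\<close>.\<close>

lemma exists_common_commuting_pair:
  fixes v f v' f' :: "'a::{field,finite} vec"
  assumes vf: "(v, f) \<in> quasi_refl_pairs 4 c" and vf': "(v', f') \<in> quasi_refl_pairs 4 c"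
  shows "\<exists>w g. (w, g) \<in> commuting_pairs 4 v f c \<and> (w, g) \<in> commuting_pairs 4 v' f' c"
proof -
  have v: "v \<in> carrier_vec 4" "v \<noteq> 0\<^sub>v 4" and f: "f \<in> carrier_vec 4" "f \<noteq> 0\<^sub>v 4"
      and fv: "f \<bullet> v = c"
    using vf by (auto simp: quasi_refl_pairs_def)
  have v': "v' \<in> carrier_vec 4" and f': "f' \<in> carrier_vec 4"
    using vf' by (auto simp: quasi_refl_pairs_def)
  let ?K = "{w \<in> carrier_vec 4. w \<bullet> f = 0 \<and> w \<bullet> f' = 0}"
  have K: "CARD('a) ^ 2 \<le> card ?K"
    using card_scalar_prod_pair_eq_0_ge[of f 2 f'] f f' by simp
  have two: "2 \<le> CARD('a)"
    using card_mono[of "UNIV :: 'a set" "{0, 1}"] by simp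
  have "\<exists>w g. w \<in> ?K \<and> w \<noteq> 0\<^sub>v 4 \<and> g \<in> carrier_vec 4 \<and> g \<noteq> 0\<^sub>v 4 \<and>
      g \<bullet> v = 0 \<and> g \<bullet> v' = 0 \<and> g \<bullet> w = c"
  proof (cases "c = 0")
    case True
    have "\<exists>w\<in>?K. w \<noteq> 0\<^sub>v 4"
    proof (rule ccontr)
      assume "\<not> ?thesis"
      then have sub: "?K \<subseteq> {0\<^sub>v 4}"
        by blast
      have "card ?K \<le> 1"
        using card_mono[OF _ sub] by simp
      moreover have "2 ^ 2 \<le> CARD('a) ^ 2"
        using two by (intro power_mono) auto
      ultimately show False
        using K by simp
    qed
    then obtain w where w: "w \<in> ?K" "w \<noteq> 0\<^sub>v 4"
      by blast
    then obtain g where "g \<in> carrier_vec 4" "g \<noteq> 0\<^sub>v 4" "g \<bullet> v = 0" "g \<bullet> v' = 0" "g \<bullet> w = 0"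
      using exists_nonzero_orthogonal3[of v 4 v' w] v v' by auto
    then show ?thesis
      using w True by blast
  next
    case False
    let ?S = "(\<lambda>(a, b). a \<cdot>\<^sub>v v + b \<cdot>\<^sub>v v') ` (UNIV :: ('a \<times> 'a) set)"
    have cardS: "card ?S \<le> CARD('a) ^ 2"
      using card_image_le[of "UNIV :: ('a \<times> 'a) set" "\<lambda>(a, b). a \<cdot>\<^sub>v v + b \<cdot>\<^sub>v v'"]
      by (simp add: card_prod power2_eq_square)
    have "1 \<cdot>\<^sub>v v + 0 \<cdot>\<^sub>v v' = v"
      using v v' by auto
    then have vS: "v \<in> ?S"
      by (metis (mono_tags, lifting) UNIV_I case_prod_conv image_iff)
    have vK: "v \<notin> ?K"
      using fv False v f comm_scalar_prod[of f 4 v] by auto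
    \<comment> \<open>The counts give only card K \<ge> q^2 \<ge> card S, which an inclusion would
      not contradict. But \<open>v\<close> lies in the span and not in the kernel, so the inclusion
      would be strict.\<close>
    have "\<not> ?K \<subseteq> ?S"
    proof
      assume "?K \<subseteq> ?S"
      then have "?K \<subset> ?S"
        using vS vK by blast
      then have "card ?K < card ?S"
        by (intro psubset_card_mono) auto
      then show False
        using K cardS by simp
    qed
    then obtain w where w: "w \<in> ?K" "w \<notin> ?S"
      by blast
    then have "w \<noteq> a \<cdot>\<^sub>v v + b \<cdot>\<^sub>v v'" for a b
      by force
    moreover have wc: "w \<in> carrier_vec 4"
      using w by blast
    ultimately obtain g where g: "g \<in> carrier_vec 4" "g \<bullet> v = 0" "g \<bullet> v' = 0" "g \<bullet> w = 1"
      using exists_separating_vec[OF v v', of w] by blast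
    have "w \<noteq> 0\<^sub>v 4" "c \<cdot>\<^sub>v g \<noteq> 0\<^sub>v 4"
      using g False by (auto simp: smult_vec_eq_0_iff wc)
    moreover have "(c \<cdot>\<^sub>v g) \<bullet> v = 0" "(c \<cdot>\<^sub>v g) \<bullet> v' = 0" "(c \<cdot>\<^sub>v g) \<bullet> w = c"
      using g v v' wc by auto
    moreover have "c \<cdot>\<^sub>v g \<in> carrier_vec 4"
      using g by simp
    ultimately show ?thesis
      using w(1) by (intro exI[of _ w] exI[of _ "c \<cdot>\<^sub>v g"] conjI) assumption+
  qed
  then obtain w g where *: "w \<in> ?K" "w \<noteq> 0\<^sub>v 4" "g \<in> carrier_vec 4" "g \<noteq> 0\<^sub>v 4"
      "g \<bullet> v = 0" "g \<bullet> v' = 0" "g \<bullet> w = c"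
    by blast
  moreover have "f \<bullet> w = 0" "f' \<bullet> w = 0"
    using * f f' comm_scalar_prod[of w 4 f] comm_scalar_prod[of w 4 f'] by auto
  ultimately show ?thesis
    by (auto simp: commuting_pairs_def quasi_refl_pairs_def)
qed

lemma quasi_refl_pairs_commute_iff:
  assumes "(v, f) \<in> quasi_refl_pairs n c" "(w, g) \<in> quasi_refl_pairs n c" "s \<noteq> 0"
  shows "quasi_refl s v f * quasi_refl s w g = quasi_refl s w g * quasi_refl s v f \<longleftrightarrow>
    (w, g) \<in> commuting_pairs n v f c \<or> quasi_refl s v f = quasi_refl s w g"
  using assms quasi_refl_commute_iff[of v n f w g s]
  by (auto simp: quasi_refl_pairs_def commuting_pairs_def)

lemma card_quasi_refl_class:
  fixes c :: "'a::{field,finite}"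
  assumes "s \<noteq> 0"
  shows "(int CARD('a) - 1) * int (card ((\<lambda>(v, f). quasi_refl s v f) ` quasi_refl_pairs n c)) =
    int (card (quasi_refl_pairs n c))"
  by (subst card_quasi_refl_image[of "quasi_refl_pairs n c" n s])
     (use assms in \<open>auto simp: quasi_refl_pairs_def smult_vec_eq_0_iff of_nat_diff\<close>)

lemma card_commuting_quasi_refls:
  fixes c :: "'a::{field,finite}"
  assumes "s \<noteq> 0" "v \<in> carrier_vec n" "f \<in> carrier_vec n"
  shows "(int CARD('a) - 1) * int (card ((\<lambda>(v, f). quasi_refl s v f) ` commuting_pairs n v f c)) =
    int (card (commuting_pairs n v f c))"
  by (subst card_quasi_refl_image[of "commuting_pairs n v f c" n s])
     (use assms in \<open>auto simp: quasi_refl_pairs_def commuting_pairs_def smult_vec_eq_0_iff of_nat_diff\<close>)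

text \<open>Decides whether the centre of the spheres is already counted among its orthogonal
  partners. If \<open>(w, g)\<close> describes the same matrix, \<open>w\<close> is a multiple of
  \<open>v\<close>, so \<open>g \<bullet> v = 0\<close> gives
  \<open>c = g \<bullet> w = 0\<close>.\<close>

lemma quasi_refl_mem_commuting_iff:
  assumes vf: "(v, f) \<in> quasi_refl_pairs n c" and s: "s \<noteq> 0"
  shows "quasi_refl s v f \<in> (\<lambda>(v, f). quasi_refl s v f) ` commuting_pairs n v f c \<longleftrightarrow> c = 0"
proof
  assume "quasi_refl s v f \<in> (\<lambda>(v, f). quasi_refl s v f) ` commuting_pairs n v f c"
  then obtain w g where wg: "quasi_refl s v f = quasi_refl s w g" "(w, g) \<in> commuting_pairs n v f c"
    by auto
  then have "dyad v f = dyad w g"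
    using vf s by (subst quasi_refl_eq_iff[symmetric]) (auto simp: quasi_refl_pairs_def commuting_pairs_def)
  then obtain \<mu> where "\<mu> \<noteq> 0" "w = \<mu> \<cdot>\<^sub>v v"
    using vf wg dyad_eq_iff[of v n f n w g] by (auto simp: quasi_refl_pairs_def commuting_pairs_def)
  then show "c = 0"
    using vf wg(2) by (auto simp: quasi_refl_pairs_def commuting_pairs_def)
next
  assume "c = 0"
  then have "(v, f) \<in> commuting_pairs n v f c"
    using vf by (auto simp: quasi_refl_pairs_def commuting_pairs_def)
  then show "quasi_refl s v f \<in> (\<lambda>(v, f). quasi_refl s v f) ` commuting_pairs n v f c"
    by force
qed

theorem proposition3p1:
  fixes k :: nat and q :: int and t :: "'a :: {field, finite} mat"
    and X :: "'a mat set" and \<Gamma> :: "'a mat pair_pre_digraph"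
  assumes "q = int CARD('a)"
    and "k \<in> (if CHAR('a) = 2 then {1} else {1, 3})"
    and "t = std_involution 4 k"
    and "X = conjugacy_class (GL TYPE('a) 4) t"
    and "\<Gamma> = commuting_graph (GL TYPE('a) 4) X"
  shows "graph_diam \<Gamma> = 2 \<and>
    int (card (sphere_at \<Gamma> 1 t)) =
      (if CHAR('a) = 2 then q ^ 4 + 2 * q ^ 3 - q ^ 2 - q - 2 else q ^ 4 + q ^ 3 + q ^ 2) \<and>
    int (card (sphere_at \<Gamma> 2 t)) =
      (if CHAR('a) = 2 then q ^ 6 + q ^ 5 - 2 * q ^ 3 else q ^ 6 + q ^ 5 - q ^ 2 - 1)"
proof -
  obtain s v f where s: "s \<noteq> 0" and vf: "(v, f) \<in> quasi_refl_pairs 4 (- 2 :: 'a)"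
      and t: "t = quasi_refl s v f"
    using std_involution_quasi_refl[OF assms(2)] assms(3) by blast
  \<comment> \<open>Naming the value turns the characteristic into the condition
    \<open>c = 0\<close>, in which all counts are phrased.\<close>
  define c where "c = (- 2 :: 'a)"
  note vf = vf[folded c_def]
  let ?h = "\<lambda>(v, f). quasi_refl s v f"
  have X: "X = ?h ` quasi_refl_pairs 4 c"
    using conjugacy_class_quasi_refl[OF vf] assms(4) t by simp
  have tX: "t \<in> X"
    using vf t X by force
  have q2: "2 \<le> q"
    using card_mono[of "UNIV :: 'a set" "{0, 1}"] assms(1) by simp
  have c0: "c = 0 \<longleftrightarrow> CHAR('a) = 2"
    by (simp add: c_def two_eq_0_iff_CHAR)

  have common: "\<exists>z\<in>X. x * z = z * x \<and> z * y = y * z" if "x \<in> X" "y \<in> X" for x y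
  proof -
    from that obtain u a w b where x: "x = quasi_refl s u a" "(u, a) \<in> quasi_refl_pairs 4 c"
        and y: "y = quasi_refl s w b" "(w, b) \<in> quasi_refl_pairs 4 c"
      unfolding X by auto
    obtain z d where zd: "(z, d) \<in> commuting_pairs 4 u a c" "(z, d) \<in> commuting_pairs 4 w b c"
      using exists_common_commuting_pair[OF x(2) y(2)] by blast
    then have mem: "(z, d) \<in> quasi_refl_pairs 4 c"
      by (simp add: commuting_pairs_def)
    have "x * quasi_refl s z d = quasi_refl s z d * x" "quasi_refl s z d * y = y * quasi_refl s z d"
      using zd quasi_refl_pairs_commute_iff[OF x(2) mem s] quasi_refl_pairs_commute_iff[OF y(2) mem s] x y
      by auto
    moreover have "quasi_refl s z d \<in> X"
      unfolding X using mem by force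
    ultimately show ?thesis
      by blast
  qed

  define C where "C = ?h ` commuting_pairs 4 v f c"
  have comm: "{x \<in> X. t * x = x * t} = insert t C"
  proof (intro equalityI subsetI)
    fix x assume "x \<in> {x \<in> X. t * x = x * t}"
    then show "x \<in> insert t C"
      unfolding X t C_def using quasi_refl_pairs_commute_iff[OF vf _ s] by force
  next
    fix x assume "x \<in> insert t C"
    then show "x \<in> {x \<in> X. t * x = x * t}"
    proof
      assume "x \<in> C"
      then obtain w g where wg: "x = quasi_refl s w g" "(w, g) \<in> commuting_pairs 4 v f c"
        unfolding C_def by auto
      then have mem: "(w, g) \<in> quasi_refl_pairs 4 c"
        by (simp add: commuting_pairs_def)
      then have "x \<in> X"
        unfolding X wg(1) by force
      then show ?thesis
        using quasi_refl_pairs_commute_iff[OF vf mem s] wg t by simp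
    qed (use tX in simp)
  qed
  have finX: "finite X"
    unfolding X by simp
  have finC: "finite C"
    unfolding C_def by (rule finite_imageI, rule finite_subset[of _ "quasi_refl_pairs 4 c"])
       (auto simp: commuting_pairs_def)
  have subX: "insert t C \<subseteq> X"
    using comm by blast
  have carr: "v \<in> carrier_vec 4" "f \<in> carrier_vec 4"
    using vf by (auto simp: quasi_refl_pairs_def)
  have cardX: "(q - 1) * int (card X) = (q ^ 4 - 1) * (q ^ 3 - (if c = 0 then 1 else 0))"
    using card_quasi_refl_class[OF s, of 4 c] card_quasi_refl_pairs[of 3 c] assms(1) X by simp
  have cardC: "(q - 1) * int (card C) = (if c = 0
      then (q - 1) * (q ^ 3 - 1) + (q ^ 3 - q) * (q ^ 2 - 1) else (q ^ 3 - 1) * q ^ 2)"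
    using card_commuting_quasi_refls[OF s carr, of c] card_commuting_pairs_nonzero[of v f 2 c]
      card_commuting_pairs_zero[of v f 2] vf assms(1)
    unfolding C_def by (cases "c = 0") simp_all
  have tC: "t \<in> C \<longleftrightarrow> c = 0"
    unfolding t C_def by (rule quasi_refl_mem_commuting_iff[OF vf s])
  \<comment> \<open>The sizes are known only up to the factor q - 1; cancelling it lets the closed
    forms be checked by expanding products instead of dividing polynomials.\<close>
  have cancel: "a = b" if "(q - 1) * a = (q - 1) * b" for a b
    using that q2 by simp

  have X_poly: "int (card X) = (if c = 0 then q ^ 6 + q ^ 5 + q ^ 4 - q ^ 2 - q - 1
      else q ^ 6 + q ^ 5 + q ^ 4 + q ^ 3)"
    by (rule cancel, subst cardX) (simp add: algebra_simps eval_nat_numeral)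
  have C_poly: "int (card C) = (if c = 0 then q ^ 4 + 2 * q ^ 3 - q ^ 2 - q - 1
      else q ^ 4 + q ^ 3 + q ^ 2)"
    by (rule cancel, subst cardC) (simp add: algebra_simps eval_nat_numeral)

  let ?G = "GL TYPE('a) 4"
  have common': "\<exists>z\<in>X. x \<otimes>\<^bsub>?G\<^esub> z = z \<otimes>\<^bsub>?G\<^esub> x \<and> z \<otimes>\<^bsub>?G\<^esub> y = y \<otimes>\<^bsub>?G\<^esub> z"
    if "x \<in> X" "y \<in> X" for x y
    using common[OF that] by simp
  have S1: "sphere_at \<Gamma> 1 t = C - {t}"
    using sphere_at_1_commuting_graph[of X ?G, OF common' tX] comm assms(5) by simp
  have S2: "sphere_at \<Gamma> 2 t = X - insert t C"
    using sphere_at_2_commuting_graph[of X ?G, OF common' tX] comm assms(5) by simp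
  have card1: "int (card (sphere_at \<Gamma> 1 t)) =
      (if c = 0 then q ^ 4 + 2 * q ^ 3 - q ^ 2 - q - 2 else q ^ 4 + q ^ 3 + q ^ 2)"
  \<comment> \<open>In characteristic two \<open>t\<close> lies in \<open>C\<close> and is
    discarded, which turns the constant -1 of \<open>C_poly\<close> into -2. Otherwise
    \<open>C\<close> avoids \<open>t\<close> and is the whole sphere.\<close>
  proof (cases "c = 0")
    case True
    then have "card C > 0"
      using tC finC by (auto simp: card_gt_0_iff)
    then show ?thesis
      using True tC C_poly unfolding S1 by (simp add: card_Diff_singleton of_nat_diff)
  qed (use tC C_poly S1 in simp)
  have "int (card (X - insert t C)) = int (card X) - int (card (insert t C))"
    using subX finX card_mono[OF finX subX]
    by (subst card_Diff_subset) (auto simp: of_nat_diff intro: finite_subset)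
  \<comment> \<open>For nonzero \<open>c\<close>, \<open>t\<close> is a new element of
    \<open>insert t C\<close>; this is the origin of the final -1.\<close>
  also have "\<dots> = (if c = 0 then q ^ 6 + q ^ 5 - 2 * q ^ 3 else q ^ 6 + q ^ 5 - q ^ 2 - 1)"
    using X_poly C_poly tC finC by (simp add: card_insert_if)
  finally have card2: "int (card (sphere_at \<Gamma> 2 t)) =
      (if c = 0 then q ^ 6 + q ^ 5 - 2 * q ^ 3 else q ^ 6 + q ^ 5 - q ^ 2 - 1)"
    unfolding S2 .
  \<comment> \<open>A non-commuting pair, and with it the lower bound on the diameter, comes without
    a construction: the polynomial for the second sphere is positive for q \<ge> 2.\<close>
  have pos: "0 < int (card (sphere_at \<Gamma> 2 t))"
  proof -
    have pow: "2 ^ m \<le> q ^ m" for m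
      using q2 by (intro power_mono) auto
    have "q ^ 3 * 2 ^ 3 \<le> q ^ 3 * q ^ 3" "q ^ 2 * 2 ^ 3 \<le> q ^ 2 * q ^ 3"
      using q2 by (intro mult_left_mono pow; simp)+
    then have "8 * q ^ 3 \<le> q ^ 6" "8 * q ^ 2 \<le> q ^ 5"
      by (simp_all flip: power_add)
    moreover have "8 \<le> q ^ 3" "4 \<le> q ^ 2"
      using pow[of 3] pow[of 2] by simp_all
    ultimately show ?thesis
      unfolding card2 by auto
  qed
  then obtain x where "x \<in> sphere_at \<Gamma> 2 t"
    by (metis card.empty ex_in_conv less_irrefl of_nat_0)
  then have "x \<in> X" "t * x \<noteq> x * t"
    unfolding S2 comm[symmetric] by auto
  then have "\<exists>x\<in>X. \<exists>y\<in>X. x \<otimes>\<^bsub>GL TYPE('a) 4\<^esub> y \<noteq> y \<otimes>\<^bsub>GL TYPE('a) 4\<^esub> x"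
    using tX by auto
  then have "graph_diam \<Gamma> = 2"
    using graph_diam_commuting_graph[of X ?G, OF common'] assms(5) by simp
  then show ?thesis
    using card1 card2 c0 by simp
qed

end
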